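(* Let $r\colon\{1,2,\ldots\}\to(0,\infty)$ be non-decreasing with $\lim_{k\to\infty} r(k)=1$, and let $\overline{\rho}\in(0,\infty)$. There is a constant $\kappa<\infty$, depending only on $\overline{\rho}$ and $r$, such that for all integers $n,m\ge1$ with $m/n\le\overline{\rho}$, the mean-field zero-range process with rate function $r$, $n$ sites and $m$ particles satisfies $$t_{\mathrm{mix}}(x;\varepsilon)\ \le\ \kappa\|x\|_\infty+(\ln n)^\kappa$$ for every $x\in\Omega$ and every $\varepsilon\in(0,1)$, provided $n\ge\kappa/\varepsilon$.
   Context: Given integers $n,m\ge1$, the mean-field zero-range process with rate function $r$ (with the convention $r(0)=0$) is the continuous-time Markov chain $(X(t))_{t\ge0}$ on $\Omega=\{x\in\mathbb{Z}_+^n:\sum_{i=1}^n x_i=m\}$ with generator $(\mathcal{L}\varphi)(x)=\frac1n\sum_{1\le i,j\le n}r(x_i)\left(\varphi(x+\delta_j-\delta_i)-\varphi(x)\right)$, where $(\delta_i)$ is the canonical basis of $\mathbb{Z}_+^n$. It is irreducible, with reversible probability law $\pi(x)\propto\prod_{i=1}^n\prod_{k=1}^{x_i}\frac1{r(k)}$. $\mathbb{P}_x$ denotes the law of the process started from $X(0)=x$. The mixing time from $x\in\Omega$ with precision $\varepsilon\in(0,1)$ is $t_{\mathrm{mix}}(x;\varepsilon)=\min\{t\ge0:\|\mathbb{P}_x(X(t)\in\cdot)-\pi\|_{\mathrm{TV}}\le\varepsilon\}$, where $\|\mu-\nu\|_{\mathrm{TV}}=\max_{A\subseteq\Omega}|\mu(A)-\nu(A)|$.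 Also $\|x\|_\infty=\max_{1\le i\le n}x_i$. *)

theory Defs
  imports "HOL-Probability.Probability"
begin

section \<open>Continuous-time Markov chains on a finite state space\<close>

text \<open>
  Time is \<open>{0..}\<close>; the kernels \<open>p t\<close> are irrelevant for \<open>t < 0\<close>.
\<close>

definition transition_function :: "'s set \<Rightarrow> (real \<Rightarrow> 's \<Rightarrow> 's pmf) \<Rightarrow> bool" where
  "transition_function S p \<longleftrightarrow>
     (\<forall>t\<ge>0. \<forall>x\<in>S. set_pmf (p t x) \<subseteq> S) \<and>
     (\<forall>x\<in>S. p 0 x = return_pmf x) \<and>
     (\<forall>s\<ge>0. \<forall>t\<ge>0. \<forall>x\<in>S. p (s + t) x = bind_pmf (p s x) (p t))"

text \<open>
  The generator is the right derivative at time 0 of the semigroup. As \<open>S\<close> is meant to be finite,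
  all observables \<open>\<phi>\<close> are in its domain.
\<close>

definition has_generator ::
    "'s set \<Rightarrow> (real \<Rightarrow> 's \<Rightarrow> 's pmf) \<Rightarrow> (('s \<Rightarrow> real) \<Rightarrow> 's \<Rightarrow> real) \<Rightarrow> bool" where
  "has_generator S p L \<longleftrightarrow>
     (\<forall>\<phi>. \<forall>x\<in>S.
        ((\<lambda>t. (measure_pmf.expectation (p t x) \<phi> - \<phi> x) / t) \<longlongrightarrow> L \<phi> x) (at_right 0))"

text \<open>
  \<open>P\<close> is the law, on the space of trajectories \<open>{0..} \<rightarrow> S\<close> with the product sigma-algebra, of the
  Markov chain with generator \<open>L\<close> started from \<open>x\<close>; the chain at time \<open>t\<close> is the coordinate
  \<open>\<omega> t\<close>. The Markov property is stated in product form, the last conditioning time \<open>s\<close> being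
  the present and the remaining elements of \<open>J\<close> the past.
\<close>

definition markov_chain_law ::
    "'s set \<Rightarrow> (('s \<Rightarrow> real) \<Rightarrow> 's \<Rightarrow> real) \<Rightarrow> 's \<Rightarrow> (real \<Rightarrow> 's) measure \<Rightarrow> bool" where
  "markov_chain_law S L x P \<longleftrightarrow>
     prob_space P \<and>
     sets P = sets (PiM {0..} (\<lambda>_. count_space S)) \<and>
     (AE \<omega> in P. \<omega> 0 = x) \<and>
     (\<exists>p. transition_function S p \<and> has_generator S p L \<and>
        (\<forall>s\<ge>0. \<forall>t\<ge>0. \<forall>J h. \<forall>y\<in>S. finite J \<and> s \<in> J \<and> J \<subseteq> {0..s} \<longrightarrow>
           \<P>(\<omega> in P. (\<forall>u\<in>J. \<omega> u = h u) \<and> \<omega> (s + t) = y)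
           = \<P>(\<omega> in P. \<forall>u\<in>J. \<omega> u = h u) * pmf (p t (h s)) y))"

definition tv_dist :: "'s set \<Rightarrow> 's measure \<Rightarrow> 's measure \<Rightarrow> real" where
  "tv_dist S \<mu> \<nu> = Max ((\<lambda>A. \<bar>measure \<mu> A - measure \<nu> A\<bar>) ` Pow S)"

text \<open>
  The infimum is taken in \<open>ereal\<close>, so that it would be \<open>\<infinity>\<close> if the precision were never reached.
\<close>

definition mixing_time ::
    "'s set \<Rightarrow> (real \<Rightarrow> 's) measure \<Rightarrow> 's measure \<Rightarrow> real \<Rightarrow> ereal" where
  "mixing_time S P \<pi> \<epsilon> =
     (INF t \<in> {t. 0 \<le> t \<and> tv_dist S (distr P (count_space S) (\<lambda>\<omega>. \<omega> t)) \<pi> \<le> \<epsilon>}. ereal t)"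


section \<open>The mean-field zero-range process\<close>

text \<open>
  Vectors indexed by \<open>{1..n}\<close> are functions on \<open>nat\<close> that vanish outside \<open>{1..n}\<close>.
\<close>

definition zrp_states :: "nat \<Rightarrow> nat \<Rightarrow> (nat \<Rightarrow> nat) set" where
  "zrp_states n m = {x. (\<forall>i. i \<notin> {1..n} \<longrightarrow> x i = 0) \<and> (\<Sum>i=1..n. x i) = m}"

text \<open>
  \<open>x + \<delta>\<^sub>j - \<delta>\<^sub>i\<close>. The truncated subtraction only takes effect when \<open>x i = 0\<close> and \<open>i \<noteq> j\<close>,
  in which case the jump has rate \<open>r 0 = 0\<close>.
\<close>

definition move_particle :: "nat \<Rightarrow> nat \<Rightarrow> (nat \<Rightarrow> nat) \<Rightarrow> nat \<Rightarrow> nat" where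
  "move_particle i j x = (\<lambda>k. x k + of_bool (k = j) - of_bool (k = i))"

definition zrp_generator ::
    "(nat \<Rightarrow> real) \<Rightarrow> nat \<Rightarrow> ((nat \<Rightarrow> nat) \<Rightarrow> real) \<Rightarrow> (nat \<Rightarrow> nat) \<Rightarrow> real" where
  "zrp_generator r n \<phi> x =
     1 / real n * (\<Sum>i=1..n. \<Sum>j=1..n. r (x i) * (\<phi> (move_particle i j x) - \<phi> x))"

definition zrp_weight :: "(nat \<Rightarrow> real) \<Rightarrow> nat \<Rightarrow> (nat \<Rightarrow> nat) \<Rightarrow> real" where
  "zrp_weight r n x = (\<Prod>i=1..n. \<Prod>k=1..x i. 1 / r k)"

definition zrp_equilibrium :: "(nat \<Rightarrow> real) \<Rightarrow> nat \<Rightarrow> nat \<Rightarrow> (nat \<Rightarrow> nat) measure" where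
  "zrp_equilibrium r n m =
     point_measure (zrp_states n m)
       (\<lambda>x. ennreal (zrp_weight r n x / (\<Sum>y\<in>zrp_states n m. zrp_weight r n y)))"

definition zrp_law ::
    "(nat \<Rightarrow> real) \<Rightarrow> nat \<Rightarrow> nat \<Rightarrow> (nat \<Rightarrow> nat) \<Rightarrow> (real \<Rightarrow> nat \<Rightarrow> nat) measure \<Rightarrow> bool" where
  "zrp_law r n m x P \<longleftrightarrow> markov_chain_law (zrp_states n m) (zrp_generator r n) x P"

definition sup_norm :: "nat \<Rightarrow> (nat \<Rightarrow> nat) \<Rightarrow> nat" where
  "sup_norm n x = Max (x ` {1..n})"

end

theory Submission
  imports Defs
begin

text \<open>
  Couple two copies of the process that differ by the position of one particle: they consist of a
  common configuration \<open>z\<close> and two second-class particles at sites \<open>i\<close> and \<open>j\<close>. With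
  \<open>g k = r (k + 1) - r k\<close>, the two particles make a common jump, and coalesce, at rate
  \<open>min (g (z i)) (g (z j))\<close>, and the excess rates make one of them jump alone to a uniform site.
  Hence \<open>f (z + \<delta>\<^sub>i) - f (z + \<delta>\<^sub>j)\<close> evolves by the generator of the triple \<open>(z, i, j)\<close> killed at
  coalescence, and it decays like \<open>exp (- c t) W\<close> once there is \<open>W \<ge> 1\<close> on which this generator is
  at most \<open>- c W\<close>.

  A site is refilled at rate at most \<open>1 - \<nu>\<close>, where \<open>\<nu>\<close> is the fraction of vacant sites, and drained
  at a rate close to \<open>1\<close> when it is high, so \<open>\<theta> ^ z i\<close> decreases on average as long as \<open>\<nu>\<close> is
  bounded away from \<open>0\<close>. This can fail at some configurations, but it holds on average in time: the
  mean \<open>\<Phi>\<close> of \<open>\<eta> ^ z l\<close> over the sites is at least \<open>\<eta> powr \<rho>\<close> by convexity and has drift at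
  least \<open>\<Phi> - 2 \<nu>\<close>, so that \<open>G\<^sub>i = (B - \<Phi>) \<theta> ^ z i\<close> satisfies a drift condition at every
  configuration. One takes \<open>W = G\<^sub>i + G\<^sub>j + M G + C - \<Lambda> \<eta> ^ (z i + z j)\<close>, where \<open>G\<close>, the
  mean of the \<open>G\<^sub>l\<close>, pays for the jumps of the second-class particles to uniform sites, and the last
  term brings the pair from bounded heights to \<open>z i = z j = 0\<close>, where it is killed at rate \<open>r 1\<close>.

  Finally, any two configurations are joined by at most \<open>m\<close> moves of one particle, and the stationary
  mean of \<open>\<theta> ^ y l\<close> is bounded by the same drift condition. Since \<open>W\<close> is of order
  \<open>n \<theta> ^ \<parallel>x\<parallel>\<close> at most, time \<open>\<kappa> \<parallel>x\<parallel> + \<kappa> ln n\<close> is enough.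
\<close>

section \<open>Configurations\<close>

text \<open>Adding a particle involves no truncated subtraction. Two configurations that differ by
  one move are \<open>bump i z\<close> and \<open>bump j z\<close> over a common \<open>z\<close>
  with one particle less.\<close>

definition bump :: "nat \<Rightarrow> (nat \<Rightarrow> nat) \<Rightarrow> nat \<Rightarrow> nat" where
  "bump i z = z(i := Suc (z i))"

definition avg :: "nat \<Rightarrow> (nat \<Rightarrow> real) \<Rightarrow> real" where
  "avg n f = (\<Sum>l=1..n. f l) / real n"

lemma sum_double_delta:
  fixes c :: real and i j n :: nat
  assumes "i \<in> {1..n}" "j \<in> {1..n}"
  shows "(\<Sum>k=1..n. \<Sum>l=1..n. if k = i then if l = j then c else 0 else 0) = c"
proof -
  have "(\<Sum>l=1..n. if k = i then if l = j then c else 0 else 0) = (if k = i then c else 0)" for k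
    using assms(2) by (cases "k = i") simp_all
  then show ?thesis using assms(1) by simp
qed

lemma avg_mono: "(\<And>l. l \<in> {1..n} \<Longrightarrow> f l \<le> g l) \<Longrightarrow> avg n f \<le> avg n g"
  unfolding avg_def by (intro divide_right_mono sum_mono) auto

lemma avg_const: "1 \<le> n \<Longrightarrow> avg n (\<lambda>_. c) = c"
  by (simp add: avg_def)

lemma avg_diff: "avg n (\<lambda>l. f l - g l) = avg n f - avg n g"
  by (simp add: avg_def sum_subtractf diff_divide_distrib)

lemma avg_add: "avg n (\<lambda>l. f l + g l) = avg n f + avg n g"
  by (simp add: avg_def sum.distrib add_divide_distrib)

lemma avg_cmult: "avg n (\<lambda>l. c * f l) = c * avg n f"
  by (simp add: avg_def sum_distrib_left)

lemma finite_zrp_states: "finite (zrp_states n m)"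
proof (rule finite_subset)
  show "zrp_states n m \<subseteq> {f. \<forall>i. (i \<in> {1..n} \<longrightarrow> f i \<in> {..m}) \<and> (i \<notin> {1..n} \<longrightarrow> f i = 0)}"
  proof (intro subsetI CollectI allI conjI impI)
    fix x i assume x: "x \<in> zrp_states n m"
    { assume "i \<in> {1..n}"
      then have "x i \<le> (\<Sum>i=1..n. x i)"
        by (intro member_le_sum) auto
      with x show "x i \<in> {..m}" by (simp add: zrp_states_def) }
    assume "i \<notin> {1..n}" with x show "x i = 0" by (simp add: zrp_states_def)
  qed
  show "finite {f. \<forall>i. (i \<in> {1..n} \<longrightarrow> f i \<in> {..m}) \<and> (i \<notin> {1..n} \<longrightarrow> f i = (0::nat))}"
    by (rule finite_set_of_finite_funs) auto
qed

lemma sum_bump: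
  assumes "i \<in> {1..n}"
  shows "(\<Sum>k=1..n. bump i z k) = Suc (\<Sum>k=1..n. z k)"
proof -
  have "(\<Sum>k=1..n. bump i z k) = (\<Sum>k=1..n. z k + (if k = i then 1 else 0))"
    by (intro sum.cong) (auto simp: bump_def)
  also have "\<dots> = Suc (\<Sum>k=1..n. z k)"
    using assms by (simp add: sum.distrib)
  finally show ?thesis .
qed

lemma bump_in_states:
  assumes "i \<in> {1..n}"
  shows "bump i z \<in> zrp_states n (Suc m) \<longleftrightarrow> z \<in> zrp_states n m"
proof -
  have "(\<forall>k. k \<notin> {1..n} \<longrightarrow> bump i z k = 0) \<longleftrightarrow> (\<forall>k. k \<notin> {1..n} \<longrightarrow> z k = 0)"
    using assms by (auto simp: bump_def)
  then show ?thesis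
    using sum_bump[OF assms, of z] by (simp add: zrp_states_def del: atLeastAtMost_iff)
qed

lemma inj_bump: "inj (bump i)"
proof (rule injI)
  fix y z assume e: "bump i y = bump i z"
  show "y = z"
  proof
    fix k show "y k = z k"
      using fun_cong[OF e, of k] by (auto simp: bump_def split: if_splits)
  qed
qed

text \<open>Removing the particle about to leave site \<open>i\<close> is the change of variables
  behind the stationarity of the weights.\<close>

lemma occupied_states_eq_bump_image:
  assumes "i \<in> {1..n}"
  shows "{x \<in> zrp_states n (Suc m). x i \<noteq> 0} = bump i ` zrp_states n m"
proof (intro equalityI subsetI)
  fix x assume x: "x \<in> {x \<in> zrp_states n (Suc m). x i \<noteq> 0}"
  then have eq: "x = bump i (x(i := x i - 1))" by (auto simp: bump_def)
  with x bump_in_states[OF assms, of "x(i := x i - 1)" m] show "x \<in> bump i ` zrp_states n m"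
    by (metis (lifting) image_eqI mem_Collect_eq)
next
  fix x assume "x \<in> bump i ` zrp_states n m"
  then show "x \<in> {x \<in> zrp_states n (Suc m). x i \<noteq> 0}"
    using bump_in_states[OF assms] by (auto simp: bump_def)
qed

lemma bump_same: "bump i z i = Suc (z i)"
  by (simp add: bump_def)

lemma move_bump_self: "move_particle i l (bump i z) = bump l z"
  by (auto simp: move_particle_def bump_def)

lemma move_bump_commute:
  "z k \<noteq> 0 \<Longrightarrow> move_particle k l (bump i z) = bump i (move_particle k l z)"
  by (auto simp: move_particle_def bump_def fun_eq_iff)

lemma move_as_bump:
  assumes "x k \<noteq> 0"
  obtains z where "x = bump k z" "move_particle k l x = bump l z"
proof
  show x: "x = bump k (x(k := x k - 1))" using assms by (auto simp: bump_def)
  show "move_particle k l x = bump l (x(k := x k - 1))"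
    by (subst x) (rule move_bump_self)
qed

lemma move_in_states:
  assumes "x \<in> zrp_states n m" "x k \<noteq> 0" "l \<in> {1..n}"
  shows "move_particle k l x \<in> zrp_states n m"
proof -
  obtain z where z: "x = bump k z" "move_particle k l x = bump l z"
    using move_as_bump assms(2) .
  have k: "k \<in> {1..n}" using assms by (auto simp: zrp_states_def)
  then have "x k \<le> m"
    using assms(1) member_le_sum[OF k, of x] by (simp add: zrp_states_def)
  then obtain m' where m: "m = Suc m'" using assms(2) by (cases m) auto
  show ?thesis using z assms bump_in_states[OF k, of z m'] bump_in_states[OF assms(3), of z m'] m
    by simp
qed

section \<open>Semigroups on a finite state space\<close>

lemma expectation_finite:
  fixes g :: "'s \<Rightarrow> real"
  assumes "finite S" "set_pmf q \<subseteq> S"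
  shows "measure_pmf.expectation q g = (\<Sum>y\<in>S. g y * pmf q y)"
  using assms by (intro integral_measure_pmf_real) auto

lemma transition_prob_add:
  assumes p: "transition_function S p" and x: "x \<in> S" and st: "0 \<le> s" "0 \<le> t"
  shows "measure_pmf.prob (p (s + t) x) A = measure_pmf.expectation (p s x) (\<lambda>y. measure_pmf.prob (p t y) A)"
proof -
  have set: "set_pmf (p s x) \<subseteq> S" and bind: "p (s + t) x = bind_pmf (p s x) (p t)"
    using p x st by (auto simp: transition_function_def)
  show ?thesis
    unfolding bind measure_pmf_bind
    by (rule measure_pmf.measure_bind[where N="count_space UNIV"])
      (auto intro: measure_pmf_in_subprob_algebra)
qed

text \<open>\<open>has_generator\<close> gives a limit for each observable separately. Expanding in
  indicators of points leaves finitely many limits, so one \<open>h0\<close> serves all observables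
  bounded by 1. This is needed because the Euler steps below are applied to the semigroup itself, an
  observable that varies with the time.\<close>

lemma transition_uniform_derivative:
  fixes L :: "('s \<Rightarrow> real) \<Rightarrow> 's \<Rightarrow> real"
  assumes p: "transition_function S p" and gen: "has_generator S p L" and S: "finite S" and e: "0 < e"
    and L: "\<And>g x. x \<in> S \<Longrightarrow> L g x = (\<Sum>y\<in>S. g y * L (indicat_real {y}) x)"
  obtains h0 where "0 < h0"
    "\<And>h g x. \<lbrakk>0 < h; h < h0; \<And>y. y \<in> S \<Longrightarrow> \<bar>g y\<bar> \<le> 1; x \<in> S\<rbrakk> \<Longrightarrow>
      \<bar>measure_pmf.expectation (p h x) g - g x - h * L g x\<bar> \<le> h * e"
proof -
  define e' where "e' = e / (card S + 1)"
  have e': "0 < e'" "card S * e' \<le> e" using e by (auto simp: e'_def field_simps)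
  define Q where "Q = (\<lambda>h x y. (measure_pmf.expectation (p h x) (indicat_real {y}) - indicat_real {y} x) / h)"
  have "\<forall>\<^sub>F h in at_right 0. \<forall>x\<in>S. \<forall>y\<in>S. dist (Q h x y) (L (indicat_real {y}) x) < e'"
    unfolding Q_def using gen e'(1)
    by (intro eventually_ball_finite S ballI tendstoD) (simp_all only: has_generator_def)
  then obtain h0 where h0: "0 < h0"
    "\<And>h x y. \<lbrakk>0 < h; h < h0; x \<in> S; y \<in> S\<rbrakk> \<Longrightarrow> \<bar>Q h x y - L (indicat_real {y}) x\<bar> < e'"
    unfolding eventually_at_right_field dist_real_def by auto
  show thesis
  proof (rule that[OF h0(1)])
    fix h x and g :: "'s \<Rightarrow> real" assume h: "0 < h" "h < h0" and g: "\<And>y. y \<in> S \<Longrightarrow> \<bar>g y\<bar> \<le> 1" and x: "x \<in> S"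
    have set: "set_pmf (p h x) \<subseteq> S" using p x h by (auto simp: transition_function_def)
    have "pmf (p h x) y - indicat_real {y} x = h * Q h x y" for y
      using h by (simp add: Q_def measure_pmf_single)
    then have "(\<Sum>y\<in>S. g y * (pmf (p h x) y - indicat_real {y} x)) = (\<Sum>y\<in>S. g y * (h * Q h x y))"
      by simp
    moreover have "(\<Sum>y\<in>S. g y * indicat_real {y} x) = g x"
    proof -
      have "(\<Sum>y\<in>S. g y * indicat_real {y} x) = (\<Sum>y\<in>S. if y = x then g y else 0)"
        by (intro sum.cong) auto
      then show ?thesis using x S by simp
    qed
    ultimately have "measure_pmf.expectation (p h x) g - g x = (\<Sum>y\<in>S. g y * (h * Q h x y))"
      by (simp add: expectation_finite[OF S set] right_diff_distrib sum_subtractf)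
    then have "measure_pmf.expectation (p h x) g - g x - h * L g x
      = h * (\<Sum>y\<in>S. g y * (Q h x y - L (indicat_real {y}) x))"
      by (simp add: L[OF x, of g] sum_distrib_left sum_subtractf algebra_simps)
    moreover have "\<bar>\<Sum>y\<in>S. g y * (Q h x y - L (indicat_real {y}) x)\<bar> \<le> (\<Sum>y\<in>S. 1 * e')"
      using g h0(2)[OF h x] by (intro order_trans[OF sum_abs] sum_mono, unfold abs_mult, intro mult_mono) (auto intro: less_imp_le)
    ultimately show "\<bar>measure_pmf.expectation (p h x) g - g x - h * L g x\<bar> \<le> h * e"
      using h e'(2) by (simp add: abs_mult)
  qed
qed

lemma le_if_le_add_epsilon:
  fixes x y c :: real
  assumes "\<And>e. 0 < e \<Longrightarrow> x \<le> y + c * e" "0 \<le> c"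
  shows "x \<le> y"
proof (rule field_le_epsilon)
  fix d :: real assume "0 < d"
  then have "x \<le> y + c * (d / (c + 1))" using assms by (intro assms(1)) auto
  also have "c * (d / (c + 1)) \<le> d" using \<open>0 < d\<close> assms(2) by (simp add: field_simps)
  finally show "x \<le> y + d" by simp
qed

lemma equal_steps:
  fixes t \<delta> :: real
  assumes "0 < t" "0 < \<delta>"
  obtains h and N :: nat where "0 < h" "h < \<delta>" "real N * h = t"
proof -
  obtain N :: nat where N: "t / \<delta> < real N" using reals_Archimedean2 by blast
  moreover have "0 < t / \<delta>" using assms by simp
  ultimately have "0 < real N" by linarith
  with N show thesis using assms by (intro that[of "t / real N" N]) (auto simp: field_simps)
qed

lemma power_one_minus_le_exp:
  fixes a :: real
  assumes "a \<le> 1"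
  shows "(1 - a) ^ N \<le> exp (- (real N * a))"
proof -
  have "(1 - a) ^ N \<le> exp (- a) ^ N"
    using assms exp_ge_add_one_self[of "- a"] by (intro power_mono) auto
  then show ?thesis by (simp add: exp_of_nat_mult[symmetric])
qed

section \<open>Chains of moves\<close>

text \<open>Induction on the number of surplus particles of \<open>x\<close> over \<open>y\<close>:
  each move takes a particle from a site where \<open>x\<close> exceeds \<open>y\<close> to one
  where it falls short. Such moves never exceed the sitewise maximum of the endpoints, so a common
  bound \<open>u\<close> persists along the path and \<open>E\<close> may be chosen from
  \<open>u\<close> alone.\<close>

lemma oscillation_le_sum_of_moves:
  fixes F :: "(nat \<Rightarrow> nat) \<Rightarrow> real"
  assumes E: "0 \<le> E"
    and F: "\<And>z i j. \<lbrakk>i \<in> {1..n}; j \<in> {1..n}; bump i z \<in> zrp_states n m; bump j z \<in> zrp_states n m;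
        \<And>k. z k \<le> u k\<rbrakk> \<Longrightarrow> F (bump i z) - F (bump j z) \<le> E"
    and x: "x \<in> zrp_states n m" "\<And>k. x k \<le> u k" and y: "y \<in> zrp_states n m" "\<And>k. y k \<le> u k"
  shows "F x - F y \<le> real m * E"
proof -
  have "F x - F y \<le> real d * E"
    if "x \<in> zrp_states n m" "\<And>k. x k \<le> u k" "(\<Sum>k=1..n. x k - y k) = d" for x d
    using that
  proof (induction d arbitrary: x)
    case 0
    then have le: "x k \<le> y k" for k
      using y(1) by (cases "k \<in> {1..n}") (auto simp: zrp_states_def)
    have "(\<Sum>k=1..n. y k - x k) = (\<Sum>k=1..n. y k) - (\<Sum>k=1..n. x k)"
      using le by (intro sum_subtractf_nat) auto
    also have "\<dots> = 0" using 0 y by (simp add: zrp_states_def)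
    finally have "\<forall>k\<in>{1..n}. y k \<le> x k" by simp
    then have "x k = y k" for k
      using le[of k] 0(1) y(1) by (cases "k \<in> {1..n}") (auto simp: zrp_states_def intro: antisym)
    then have "x = y" by auto
    then show ?case by simp
  next
    case (Suc d)
    have "\<exists>i\<in>{1..n}. y i < x i"
    proof (rule ccontr)
      assume "\<not> ?thesis"
      then have "(\<Sum>k=1..n. x k - y k) = 0" by (simp add: not_less)
      with Suc.prems(3) show False by simp
    qed
    then obtain i where i: "i \<in> {1..n}" "y i < x i" by blast
    \<comment> \<open>Both configurations have \<open>m\<close> particles, so a surplus at
      \<open>i\<close> forces a deficit elsewhere.\<close>
    have "\<exists>j\<in>{1..n}. x j < y j"
    proof (rule ccontr)
      assume "\<not> ?thesis"
      then have "(\<Sum>k=1..n. y k) < (\<Sum>k=1..n. x k)"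
        using i by (intro sum_strict_mono_ex1) (auto simp: not_less)
      with Suc.prems(1) y(1) show False by (simp add: zrp_states_def)
    qed
    then obtain j where j: "j \<in> {1..n}" "x j < y j" by blast
    define w where "w = x(i := x i - 1)"
    have xw: "x = bump i w" using i by (auto simp: w_def bump_def)
    have wu: "w k \<le> u k" for k using Suc.prems(2)[of k] by (auto simp: w_def)
    have "x i \<le> (\<Sum>k=1..n. x k)" using i(1) by (intro member_le_sum) auto
    then have "m \<noteq> 0" using Suc.prems(1) i by (simp add: zrp_states_def)
    then obtain m' where m: "m = Suc m'" by (cases m) auto
    have st: "bump j w \<in> zrp_states n m"
      using Suc.prems(1) i(1) j(1) bump_in_states unfolding xw m by blast
    have ij: "i \<noteq> j" using i j by auto
    have "x k - y k = (bump j w k - y k) + (if k = i then 1 else 0)" for k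
      using i j ij by (auto simp: bump_def w_def)
    then have "(\<Sum>k=1..n. x k - y k) = (\<Sum>k=1..n. (bump j w k - y k) + (if k = i then 1 else 0))"
      by simp
    then have "(\<Sum>k=1..n. bump j w k - y k) = d"
      using Suc.prems(3) i(1) by (simp add: sum.distrib)
    moreover have "bump j w k \<le> u k" for k
      using j y(2)[of k] wu[of k] ij by (auto simp: bump_def w_def)
    ultimately have "F (bump j w) - F y \<le> real d * E"
      by (intro Suc.IH st)
    moreover have "F x - F (bump j w) \<le> E"
      using Suc.prems(1) st i(1) j(1) wu unfolding xw by (intro F)
    ultimately show ?case by (simp add: algebra_simps)
  qed
  from this[OF x refl] have "F x - F y \<le> real (\<Sum>k=1..n. x k - y k) * E" .
  also have "\<dots> \<le> real (\<Sum>k=1..n. x k) * E"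
    by (intro mult_right_mono E of_nat_mono sum_mono) auto
  also have "(\<Sum>k=1..n. x k) = m" using x by (simp add: zrp_states_def)
  finally show ?thesis .
qed

section \<open>Marginals and mixing times\<close>

text \<open>With present time 0 and \<open>J = {0}\<close>, the Markov property reads off the law at
  time \<open>t\<close>, since the start is almost surely \<open>x\<close>. Singletons suffice
  because \<open>S\<close> is finite.\<close>

lemma markov_chain_law_marginal:
  assumes P: "markov_chain_law S L x P" and S: "finite S" and x: "x \<in> S"
  obtains p where "transition_function S p" "has_generator S p L"
    "\<And>t A. \<lbrakk>0 \<le> t; A \<subseteq> S\<rbrakk> \<Longrightarrow>
      measure (distr P (count_space S) (\<lambda>\<omega>. \<omega> t)) A = measure_pmf.prob (p t x) A"
proof -
  interpret prob_space P using P by (simp add: markov_chain_law_def)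
  have sets[measurable_cong]: "sets P = sets (PiM {0..} (\<lambda>_. count_space S))"
    and start: "AE \<omega> in P. \<omega> 0 = x" using P by (auto simp: markov_chain_law_def)
  obtain p where p: "transition_function S p" "has_generator S p L"
    and law: "\<forall>s\<ge>0. \<forall>t\<ge>0. \<forall>J h. \<forall>y\<in>S. finite J \<and> s \<in> J \<and> J \<subseteq> {0..s} \<longrightarrow>
      \<P>(\<omega> in P. (\<forall>u\<in>J. \<omega> u = h u) \<and> \<omega> (s + t) = y)
           = \<P>(\<omega> in P. \<forall>u\<in>J. \<omega> u = h u) * pmf (p t (h s)) y"
    using P unfolding markov_chain_law_def by (elim conjE exE) (rule that)
  have coord: "(\<lambda>\<omega>. \<omega> t) \<in> P \<rightarrow>\<^sub>M count_space S" if "0 \<le> t" for t :: real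
  proof -
    have "(\<lambda>\<omega>. \<omega> t) \<in> PiM {0..} (\<lambda>_. count_space S) \<rightarrow>\<^sub>M count_space S"
      using that by (intro measurable_component_singleton) auto
    then show ?thesis by (simp cong: measurable_cong_sets add: sets)
  qed
  have ev: "{\<omega> \<in> space P. \<omega> t = y} \<in> sets P" if "0 \<le> t" "y \<in> S" for t y
  proof -
    have "(\<lambda>\<omega>. \<omega> t) -` {y} \<inter> space P \<in> sets P"
      using that by (intro measurable_sets[OF coord]) auto
    moreover have "(\<lambda>\<omega>. \<omega> t) -` {y} \<inter> space P = {\<omega> \<in> space P. \<omega> t = y}" by auto
    ultimately show ?thesis by simp
  qed
  have point: "prob {\<omega> \<in> space P. \<omega> t = y} = pmf (p t x) y" if t: "0 \<le> t" and y: "y \<in> S" for t y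
  proof -
    have "prob {\<omega> \<in> space P. \<omega> t = y} = prob {\<omega> \<in> space P. \<omega> 0 = x \<and> \<omega> t = y}"
    proof (rule prob_eq_AE)
      show "AE \<omega> in P. (\<omega> t = y) = (\<omega> 0 = x \<and> \<omega> t = y)" using start by eventually_elim auto
      have "{\<omega> \<in> space P. \<omega> 0 = x \<and> \<omega> t = y} = {\<omega> \<in> space P. \<omega> 0 = x} \<inter> {\<omega> \<in> space P. \<omega> t = y}"
        by auto
      then show "{\<omega> \<in> space P. \<omega> 0 = x \<and> \<omega> t = y} \<in> events"
        using ev[of 0 x] ev[OF t y] x by auto
    qed (rule ev[OF t y])
    also have "\<dots> = prob {\<omega> \<in> space P. \<omega> 0 = x} * pmf (p t x) y"
      using law[rule_format, of 0 t y "{0}" "\<lambda>_. x"] t y by simp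
    also have "prob {\<omega> \<in> space P. \<omega> 0 = x} = 1"
      using start ev[of 0 x] x by (subst prob_Collect_eq_1) auto
    finally show ?thesis by simp
  qed
  show thesis
  proof (rule that[OF p])
    fix t :: real and A :: "'a set" assume t: "0 \<le> t" and A: "A \<subseteq> S"
    have fin: "finite A" using A S finite_subset by blast
    interpret D: prob_space "distr P (count_space S) (\<lambda>\<omega>. \<omega> t)"
      by (rule prob_space_distr[OF coord[OF t]])
    have "measure (distr P (count_space S) (\<lambda>\<omega>. \<omega> t)) A =
        (\<Sum>y\<in>A. measure (distr P (count_space S) (\<lambda>\<omega>. \<omega> t)) {y})"
      using A fin by (intro D.finite_measure_eq_sum_singleton) auto
    also have "\<dots> = (\<Sum>y\<in>A. pmf (p t x) y)"
    proof (intro sum.cong refl)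
      fix y assume "y \<in> A"
      with A have y: "y \<in> S" by auto
      have "measure (distr P (count_space S) (\<lambda>\<omega>. \<omega> t)) {y} = prob ((\<lambda>\<omega>. \<omega> t) -` {y} \<inter> space P)"
        using y by (intro measure_distr coord t) auto
      also have "(\<lambda>\<omega>. \<omega> t) -` {y} \<inter> space P = {\<omega> \<in> space P. \<omega> t = y}" by auto
      finally show "measure (distr P (count_space S) (\<lambda>\<omega>. \<omega> t)) {y} = pmf (p t x) y"
        by (simp add: point[OF t y])
    qed
    also have "\<dots> = measure_pmf.prob (p t x) A"
      by (simp add: measure_measure_pmf_finite fin)
    finally show "measure (distr P (count_space S) (\<lambda>\<omega>. \<omega> t)) A = measure_pmf.prob (p t x) A" .
  qed
qed

lemma tv_dist_le:
  assumes "finite S" "\<And>A. A \<subseteq> S \<Longrightarrow> \<bar>measure \<mu> A - measure \<nu> A\<bar> \<le> e"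
  shows "tv_dist S \<mu> \<nu> \<le> e"
  unfolding tv_dist_def using assms by (subst Max_le_iff) auto

lemma mixing_time_le:
  assumes "0 \<le> t" "tv_dist S (distr P (count_space S) (\<lambda>\<omega>. \<omega> t)) \<pi> \<le> \<epsilon>"
  shows "mixing_time S P \<pi> \<epsilon> \<le> ereal t"
  unfolding mixing_time_def using assms by (intro INF_lower) auto

section \<open>The generator\<close>

locale zrp_rate =
  fixes r :: "nat \<Rightarrow> real"
  assumes r_0: "r 0 = 0"
    and r_pos: "\<And>k. 1 \<le> k \<Longrightarrow> 0 < r k"
    and r_mono: "mono_on {1..} r"
    and r_lim: "r \<longlonglongrightarrow> 1"
begin

lemma r_nonneg: "0 \<le> r k"
  using r_0 r_pos[of k] by (cases "k = 0") auto

lemma r_le: "1 \<le> k \<Longrightarrow> k \<le> l \<Longrightarrow> r k \<le> r l"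
  using r_mono by (auto simp: mono_on_def)

lemma r_le_1: "r k \<le> 1"
proof (cases "k = 0")
  case False
  show ?thesis
  proof (rule LIMSEQ_le_const[OF r_lim])
    show "\<exists>N. \<forall>l\<ge>N. r k \<le> r l" using r_le False by (intro exI[of _ k]) auto
  qed
qed (simp add: r_0)

text \<open>The jump rate of a second-class particle sitting on \<open>k\<close> ordinary
  ones.\<close>

definition gap :: "nat \<Rightarrow> real" where "gap k = r (Suc k) - r k"

lemma gap_nonneg: "0 \<le> gap k"
  using r_le[of k "Suc k"] r_0 r_nonneg[of "Suc k"] unfolding gap_def by (cases "k = 0") auto

lemma gap_le_1: "gap k \<le> 1"
  using r_nonneg[of k] r_le_1[of "Suc k"] unfolding gap_def by linarith

lemma gap_0: "gap 0 = r 1"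
  by (simp add: gap_def r_0)

abbreviation gen :: "nat \<Rightarrow> ((nat \<Rightarrow> nat) \<Rightarrow> real) \<Rightarrow> (nat \<Rightarrow> nat) \<Rightarrow> real" where
  "gen \<equiv> zrp_generator r"

text \<open>A move out of an empty site may leave the state space, but it carries the rate
  \<open>r 0 = 0\<close>; so values off the state space never matter.\<close>

lemma gen_eq_cong:
  assumes "z \<in> zrp_states n m" "\<And>x. x \<in> zrp_states n m \<Longrightarrow> f x = g x"
  shows "gen n f z = gen n g z"
proof -
  have *: "r (z k) * (f (move_particle k l z) - f z) = r (z k) * (g (move_particle k l z) - g z)"
    if "l \<in> {1..n}" for k l
  proof (cases "z k = 0")
    case False
    then show ?thesis using assms move_in_states[OF assms(1) False that] by simp
  qed (simp add: r_0)
  show ?thesis unfolding zrp_generator_def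
    by (intro arg_cong[where f="\<lambda>s. 1 / real n * s"] sum.cong refl *)
qed

lemma gen_add: "gen n (\<lambda>x. f x + g x) z = gen n f z + gen n g z"
  unfolding zrp_generator_def by (simp add: algebra_simps sum.distrib sum_subtractf)

lemma gen_cmult: "gen n (\<lambda>x. c * f x) z = c * gen n f z"
  unfolding zrp_generator_def by (simp add: algebra_simps sum_distrib_left sum_subtractf)

lemma gen_const: "gen n (\<lambda>x. c) z = 0"
  unfolding zrp_generator_def by simp

lemma gen_diff: "gen n (\<lambda>x. f x - g x) z = gen n f z - gen n g z"
  using gen_add[of n f "\<lambda>x. - 1 * g x" z] by (simp add: gen_cmult[of n "-1" g z, simplified])

lemma gen_sum: "finite S \<Longrightarrow> gen n (\<lambda>x. \<Sum>s\<in>S. f s x) z = (\<Sum>s\<in>S. gen n (f s) z)"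
  by (induction S rule: finite_induct) (auto simp: gen_const gen_add)

lemma gen_avg: "gen n (\<lambda>x. avg n (\<lambda>l. f l x)) z = avg n (\<lambda>l. gen n (f l) z)"
  using gen_cmult[of n "1 / real n" "\<lambda>x. \<Sum>l=1..n. f l x" z]
  by (simp add: avg_def gen_sum)

lemma gen_expand:
  assumes "x \<in> zrp_states n m"
  shows "gen n f x = (\<Sum>y\<in>zrp_states n m. f y * gen n (indicat_real {y}) x)"
proof -
  have "f x = (\<Sum>y\<in>zrp_states n m. f y * indicat_real {y} x)" if "x \<in> zrp_states n m" for x
  proof -
    have "(\<Sum>y\<in>zrp_states n m. f y * indicat_real {y} x) = (\<Sum>y\<in>zrp_states n m. if y = x then f y else 0)"
      by (intro sum.cong) auto
    then show ?thesis using that by (simp add: finite_zrp_states)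
  qed
  then have "gen n f x = gen n (\<lambda>x. \<Sum>y\<in>zrp_states n m. f y * indicat_real {y} x) x"
    by (rule gen_eq_cong[OF assms])
  also have "\<dots> = (\<Sum>y\<in>zrp_states n m. f y * gen n (indicat_real {y}) x)"
    by (subst gen_sum[OF finite_zrp_states]) (simp only: gen_cmult)
  finally show ?thesis .
qed

section \<open>Drift of a function of one site\<close>

text \<open>The rate of arrivals at \<open>i\<close> from the other sites; a jump from
  \<open>i\<close> to itself changes nothing and is left out.\<close>

definition inflow :: "nat \<Rightarrow> nat \<Rightarrow> (nat \<Rightarrow> nat) \<Rightarrow> real" where
  "inflow n i z = (\<Sum>k\<in>{1..n}-{i}. r (z k)) / real n"

definition vacancy :: "nat \<Rightarrow> (nat \<Rightarrow> nat) \<Rightarrow> real" where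
  "vacancy n z = avg n (\<lambda>l. of_bool (z l = 0))"

lemma inflow_nonneg: "0 \<le> inflow n i z"
  unfolding inflow_def by (intro divide_nonneg_nonneg sum_nonneg r_nonneg) auto

lemma vacancy_nonneg: "0 \<le> vacancy n z"
  unfolding vacancy_def avg_def by (intro divide_nonneg_nonneg sum_nonneg) auto

lemma inflow_le:
  assumes "1 \<le> n"
  shows "inflow n i z \<le> 1 - vacancy n z"
proof -
  have "inflow n i z \<le> avg n (\<lambda>k. r (z k))"
    unfolding inflow_def avg_def by (intro divide_right_mono sum_mono2 r_nonneg) auto
  also have "\<dots> \<le> avg n (\<lambda>k. 1 - of_bool (z k = 0))"
    by (intro avg_mono) (auto simp: r_0 r_le_1)
  also have "\<dots> = 1 - vacancy n z"
    using assms by (simp add: avg_diff avg_const vacancy_def)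
  finally show ?thesis .
qed

lemma inflow_le_1: "1 \<le> n \<Longrightarrow> inflow n i z \<le> 1"
  using inflow_le[of n i z] vacancy_nonneg[of n z] by linarith

text \<open>The condition \<open>h (z i) = 0\<close> discards all moves that leave the height of
  \<open>i\<close> unchanged. The factor \<open>1 - 1 / n\<close> accounts for departures from
  \<open>i\<close> that land on \<open>i\<close> again. Taking \<open>h\<close> to be an increment
  gives the generator; taking its absolute value bounds cross terms.\<close>

lemma sum_moves_site:
  assumes i: "i \<in> {1..n}" and h: "h (z i) = 0"
  shows "1 / real n * (\<Sum>k=1..n. \<Sum>l=1..n. r (z k) * h (move_particle k l z i))
    = inflow n i z * h (Suc (z i)) + (1 - 1 / real n) * r (z i) * h (z i - 1)"
proof -
  have 1: "(\<Sum>l=1..n. r (z k) * h (move_particle k l z i)) = r (z k) * h (Suc (z i))" if "k \<noteq> i" for k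
  proof -
    have "(\<Sum>l=1..n. r (z k) * h (move_particle k l z i)) =
        (\<Sum>l=1..n. if l = i then r (z k) * h (Suc (z i)) else 0)"
      using that h by (intro sum.cong) (auto simp: move_particle_def)
    then show ?thesis using i by simp
  qed
  have 2: "(\<Sum>l=1..n. r (z i) * h (move_particle i l z i)) = (real n - 1) * (r (z i) * h (z i - 1))"
  proof -
    have "(\<Sum>l=1..n. r (z i) * h (move_particle i l z i)) =
        (\<Sum>l\<in>{1..n}-{i}. r (z i) * h (z i - 1))"
      using h by (intro sum.mono_neutral_cong_right) (auto simp: move_particle_def)
    also have "\<dots> = (real n - 1) * (r (z i) * h (z i - 1))"
      using i by (simp add: of_nat_diff)
    finally show ?thesis .
  qed
  have "(\<Sum>k=1..n. \<Sum>l=1..n. r (z k) * h (move_particle k l z i))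
     = (real n - 1) * (r (z i) * h (z i - 1)) + (\<Sum>k\<in>{1..n}-{i}. r (z k) * h (Suc (z i)))"
    using i 1 2 by (subst sum.remove[of _ i]) auto
  then show ?thesis using i
    by (simp add: inflow_def sum_distrib_right[symmetric] field_simps)
qed

lemma gen_site:
  assumes "i \<in> {1..n}"
  shows "gen n (\<lambda>z. f (z i)) z =
    inflow n i z * (f (Suc (z i)) - f (z i)) + (1 - 1 / real n) * r (z i) * (f (z i - 1) - f (z i))"
  using sum_moves_site[OF assms, of "\<lambda>v. f v - f (z i)" z] by (simp add: zrp_generator_def)

text \<open>Product rule of a jump generator; the last term is the carre du champ.\<close>

lemma gen_mult:
  "gen n (\<lambda>x. f x * g x) z = f z * gen n g z + g z * gen n f z
    + 1 / real n * (\<Sum>k=1..n. \<Sum>l=1..n. r (z k) *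
        ((f (move_particle k l z) - f z) * (g (move_particle k l z) - g z)))"
  unfolding zrp_generator_def
  by (simp add: sum_distrib_left sum.distrib[symmetric] algebra_simps)

text \<open>Chosen so that \<open>r 1 * (1 / eta - 1) = 8\<close>, which beats all the upward rates together.\<close>

definition eta :: real where "eta = r 1 / (r 1 + 8)"

lemma eta_bounds: "0 < eta" "eta < 1"
  using r_pos[of 1] by (auto simp: eta_def field_simps)

lemma r1_eta: "r 1 * (1 / eta - 1) = 8"
  using r_pos[of 1] by (simp add: eta_def field_simps)

lemma eta_power: "0 < eta ^ a" "eta ^ a \<le> 1"
  using eta_bounds by (auto intro: power_le_one)

lemma r_eta:
  assumes "1 \<le> a"
  shows "8 * eta ^ a \<le> r a * (eta ^ (a - 1) - eta ^ a)"
proof -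
  have e: "eta ^ (a - 1) = eta ^ a / eta"
    using eta_bounds assms by (cases a) auto
  have "8 * eta ^ a = r 1 * (1 / eta - 1) * eta ^ a" by (simp only: r1_eta)
  also have "\<dots> = r 1 * (eta ^ (a - 1) - eta ^ a)" by (simp only: e) (simp add: algebra_simps)
  also have "\<dots> \<le> r a * (eta ^ (a - 1) - eta ^ a)"
    using assms eta_bounds by (intro mult_right_mono r_le) (auto intro: power_decreasing)
  finally show ?thesis .
qed

section \<open>The profile and the tilted site function\<close>

definition profile :: "nat \<Rightarrow> (nat \<Rightarrow> nat) \<Rightarrow> real" where
  "profile n z = avg n (\<lambda>l. eta ^ z l)"

lemma profile_nonneg: "0 \<le> profile n z"
  unfolding profile_def avg_def using eta_power(1)
  by (intro divide_nonneg_nonneg sum_nonneg) (auto intro: less_imp_le)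

lemma profile_le_1: "1 \<le> n \<Longrightarrow> profile n z \<le> 1"
  using avg_mono[of n "\<lambda>l. eta ^ z l" "\<lambda>_. 1"] eta_power(2) by (simp add: profile_def avg_const)

text \<open>Jensen's inequality by hand: \<open>eta ^ k\<close> lies above its tangent at
  \<open>\<rho>\<close>, and this tangent is decreasing while the mean height is at most
  \<open>\<rho>\<close>.\<close>

lemma profile_ge:
  assumes "1 \<le> n" "z \<in> zrp_states n m" "real m \<le> \<rho> * real n"
  shows "eta powr \<rho> \<le> profile n z"
proof -
  define q where "q = - ln eta"
  have q: "0 \<le> q" using eta_bounds by (simp add: q_def)
  have "eta powr \<rho> * (1 - q * (real k - \<rho>)) \<le> eta ^ k" for k
  proof -
    have "1 - q * (real k - \<rho>) \<le> exp (- q * (real k - \<rho>))"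
      using exp_ge_add_one_self[of "- q * (real k - \<rho>)"] by simp
    then have "eta powr \<rho> * (1 - q * (real k - \<rho>)) \<le> eta powr \<rho> * exp (- q * (real k - \<rho>))"
      by (intro mult_left_mono) auto
    also have "\<dots> = eta powr real k"
      using eta_bounds by (simp add: powr_def q_def exp_add[symmetric] algebra_simps)
    finally show ?thesis using eta_bounds by (simp add: powr_realpow)
  qed
  then have "avg n (\<lambda>l. eta powr \<rho> * (1 - q * (real (z l) - \<rho>))) \<le> profile n z"
    unfolding profile_def by (intro avg_mono)
  moreover have "avg n (\<lambda>l. eta powr \<rho> * (1 - q * (real (z l) - \<rho>)))
      = eta powr \<rho> * (1 - q * (avg n (\<lambda>l. real (z l)) - \<rho>))"
    using assms(1) by (simp add: avg_cmult avg_diff avg_const)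
  moreover have "avg n (\<lambda>l. real (z l)) \<le> \<rho>"
  proof -
    have "(\<Sum>l=1..n. real (z l)) = real m"
      using assms(2) unfolding zrp_states_def of_nat_sum[symmetric] by simp
    then show ?thesis using assms(1,3) by (simp add: avg_def divide_simps)
  qed
  then have "eta powr \<rho> * 1 \<le> eta powr \<rho> * (1 - q * (avg n (\<lambda>l. real (z l)) - \<rho>))"
    using q by (intro mult_left_mono) (auto simp: mult_nonneg_nonpos)
  ultimately show ?thesis by simp
qed

text \<open>Arrivals have rate at most 1 and cost at most the whole value \<open>eta ^ z i\<close>;
  departures are kept exactly.\<close>

lemma gen_eta_site:
  assumes "1 \<le> n" "i \<in> {1..n}"
  shows "(1 - 1 / real n) * (r (z i) * (eta ^ (z i - 1) - eta ^ z i)) - eta ^ z i \<le> gen n (\<lambda>z. eta ^ z i) z"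
proof -
  have "inflow n i z * ((1 - eta) * eta ^ z i) \<le> 1 * (1 * eta ^ z i)"
    using assms eta_bounds inflow_nonneg inflow_le_1 by (intro mult_mono) auto
  then show ?thesis by (simp add: gen_site[OF assms(2)] algebra_simps)
qed

text \<open>Site by site: at an occupied site departures gain \<open>8 * eta ^ z l\<close>, of which
  \<open>n \<ge> 2\<close> leaves half, more than enough after the loss by arrivals. A vacant site
  only loses, by at most 1, which is \<open>1 - 2\<close>.\<close>

lemma gen_profile:
  assumes n: "2 \<le> n"
  shows "profile n z - 2 * vacancy n z \<le> gen n (profile n) z"
proof -
  have "eta ^ z l - 2 * of_bool (z l = 0) \<le> gen n (\<lambda>z. eta ^ z l) z" if l: "l \<in> {1..n}" for l
  proof -
    let ?e = "eta ^ z l"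
    have q: "(1 - 1 / real n) * (r (z l) * (eta ^ (z l - 1) - ?e)) - ?e \<le> gen n (\<lambda>z. eta ^ z l) z"
      using n l by (intro gen_eta_site) auto
    show ?thesis
    proof (cases "z l = 0")
      case True
      then show ?thesis using q by simp
    next
      case False
      have "1 / 2 * (8 * ?e) \<le> (1 - 1 / real n) * (r (z l) * (eta ^ (z l - 1) - ?e))"
        using False n eta_power by (intro mult_mono[OF _ r_eta]) (auto simp: field_simps less_imp_le)
      with q False show ?thesis
        using eta_power(1)[of "z l"] by simp
    qed
  qed
  then have "avg n (\<lambda>l. eta ^ z l - 2 * of_bool (z l = 0)) \<le> avg n (\<lambda>l. gen n (\<lambda>z. eta ^ z l) z)"
    by (intro avg_mono)
  then show ?thesis
    by (simp add: profile_def[abs_def] gen_avg[symmetric] avg_diff avg_cmult vacancy_def)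
qed

lemma profile_bump:
  assumes "i \<in> {1..n}"
  shows "profile n (bump i z) = profile n z - (1 - eta) * eta ^ z i / real n"
proof -
  have "(\<Sum>l=1..n. eta ^ bump i z l) = (\<Sum>l=1..n. eta ^ z l - (if l = i then (1 - eta) * eta ^ z i else 0))"
    by (intro sum.cong) (auto simp: bump_def algebra_simps)
  then show ?thesis
    using assms by (simp add: profile_def avg_def sum_subtractf diff_divide_distrib)
qed

lemma profile_move:
  assumes "z k \<noteq> 0" "k \<in> {1..n}" "l \<in> {1..n}"
  shows "\<bar>profile n (move_particle k l z) - profile n z\<bar> \<le> 1 / real n"
proof -
  obtain w where w: "z = bump k w" "move_particle k l z = bump l w"
    using move_as_bump assms(1) .
  have "profile n (move_particle k l z) - profile n z = (1 - eta) * (eta ^ w k - eta ^ w l) / real n"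
    unfolding w(2) unfolding w(1) profile_bump[OF assms(2)] profile_bump[OF assms(3)]
    by (simp add: diff_divide_distrib add_divide_distrib algebra_simps)
  moreover have "\<bar>1 - eta\<bar> \<le> 1" "\<bar>eta ^ w k - eta ^ w l\<bar> \<le> 1"
    using eta_bounds eta_power[of "w k"] eta_power[of "w l"] by linarith+
  then have "\<bar>(1 - eta) * (eta ^ w k - eta ^ w l)\<bar> \<le> 1 * 1"
    unfolding abs_mult by (intro mult_mono) auto
  ultimately show ?thesis by (simp add: abs_divide divide_right_mono)
qed

text \<open>
  The constant \<open>B = 1 + 2 / (\<theta> - 1)\<close> makes the gain \<open>(B - 1) (\<theta> - 1) \<nu>\<close> from vacancies cancel the
  loss \<open>2 \<nu>\<close> in the drift of the profile.
\<close>

lemma gen_tilted: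
  fixes \<theta> \<rho> :: real
  assumes \<theta>: "1 < \<theta>" and n: "2 \<le> n" and i: "i \<in> {1..n}"
    and z: "z \<in> zrp_states n m" and m: "real m \<le> \<rho> * real n"
  shows "gen n (\<lambda>z. (1 + 2 / (\<theta> - 1) - profile n z) * \<theta> ^ z i) z
    \<le> \<theta> ^ z i * (- (eta powr \<rho>) + (\<theta> + 1) * (1 - (1 - 1 / real n) * r (z i) / \<theta>)
        + 2 * (\<theta> - 1) / real n)"
proof -
  define B where "B = 1 + 2 / (\<theta> - 1)"
  have B: "(B - 1) * (\<theta> - 1) = 2" "B * (\<theta> - 1) = \<theta> + 1"
    using \<theta> by (auto simp: B_def field_simps)
  define a q \<nu> where "a = z i" "q = inflow n i z" "\<nu> = vacancy n z"
  define d where "d = (1 - 1 / real n) * r a"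
  \<comment> \<open>\<open>E\<close> is what makes the bracket
    \<open>(1 - \<nu>) * (\<theta> - 1) - d * (1 - 1 / \<theta>)\<close> factor as
    \<open>(E - \<nu>) * (\<theta> - 1)\<close>.\<close>
  define E where "E = 1 - d / \<theta>"
  have q: "0 \<le> q" "q \<le> 1 - \<nu>" "0 \<le> \<nu>"
    using n inflow_nonneg inflow_le vacancy_nonneg by (auto simp: a_q_\<nu>_def)
  have d: "0 \<le> d" "d \<le> 1"
    using n r_nonneg r_le_1 by (auto simp: d_def intro!: mult_le_one)
  have E: "0 \<le> E" using d \<theta> by (simp add: E_def)
  have pos: "0 < \<theta> ^ a" using \<theta> by simp
  \<comment> \<open>At height 0 the truncated \<open>a - 1\<close> would give the wrong increment on
    the right-hand side, but then \<open>d = 0\<close>.\<close>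
  have down: "d * (\<theta> ^ (a - 1) - \<theta> ^ a) = - d * \<theta> ^ a * (1 - 1 / \<theta>)"
  proof (cases a)
    case 0
    then show ?thesis by (simp add: d_def r_0)
  next
    case (Suc b)
    then show ?thesis using \<theta> by (simp add: field_simps)
  qed
  define P where "P = B - profile n z"
  have P: "B - 1 \<le> P" "P \<le> B"
    using n profile_nonneg profile_le_1[of n z] by (auto simp: P_def)
  have "1 \<le> B" using \<theta> by (simp add: B_def)
  with P have B0: "0 \<le> B" "0 \<le> P" by auto
  have 1: "\<theta> ^ a * gen n (\<lambda>z. B - profile n z) z \<le> \<theta> ^ a * (2 * \<nu> - eta powr \<rho>)"
    using gen_profile[OF n, of z] profile_ge[OF _ z m] n pos
    by (intro mult_left_mono) (auto simp: gen_diff gen_const a_q_\<nu>_def)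
  \<comment> \<open>\<open>E\<close> and \<open>\<nu>\<close> enter with opposite signs: the first
    is paired with \<open>P \<le> B\<close>, the second with \<open>P \<ge> B - 1\<close>.\<close>
  have 2: "P * gen n (\<lambda>z. \<theta> ^ z i) z \<le> \<theta> ^ a * (E * (\<theta> + 1) - 2 * \<nu>)"
  proof -
    have "gen n (\<lambda>z. \<theta> ^ z i) z = q * (\<theta> * \<theta> ^ a - \<theta> ^ a) + d * (\<theta> ^ (a - 1) - \<theta> ^ a)"
      by (simp add: gen_site[OF i] a_q_\<nu>_def d_def)
    also have "\<dots> = \<theta> ^ a * (q * (\<theta> - 1) - d * (1 - 1 / \<theta>))"
      by (simp only: down) (simp add: algebra_simps)
    also have "\<dots> \<le> \<theta> ^ a * ((1 - \<nu>) * (\<theta> - 1) - d * (1 - 1 / \<theta>))"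
      using q pos \<theta> by (intro mult_left_mono diff_right_mono mult_right_mono) auto
    also have "\<dots> = \<theta> ^ a * ((E - \<nu>) * (\<theta> - 1))"
      using \<theta> by (simp add: E_def field_simps)
    finally have "P * gen n (\<lambda>z. \<theta> ^ z i) z \<le> P * (\<theta> ^ a * ((E - \<nu>) * (\<theta> - 1)))"
      using B0 by (intro mult_left_mono)
    also have "\<dots> = \<theta> ^ a * (E * (P * (\<theta> - 1)) - \<nu> * (P * (\<theta> - 1)))"
      by (simp add: algebra_simps)
    also have "\<dots> \<le> \<theta> ^ a * (E * (B * (\<theta> - 1)) - \<nu> * ((B - 1) * (\<theta> - 1)))"
      using P pos E q \<theta> by (intro mult_left_mono diff_mono mult_right_mono) auto
    finally show ?thesis by (simp only: B mult.commute[of 2 \<nu>])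
  qed
  \<comment> \<open>The carre du champ is of order \<open>1 / n\<close>, because a single move
    changes the profile by at most \<open>1 / n\<close>.\<close>
  have 3: "1 / real n * (\<Sum>k=1..n. \<Sum>l=1..n. r (z k) *
      (((B - profile n (move_particle k l z)) - (B - profile n z)) *
       (\<theta> ^ move_particle k l z i - \<theta> ^ z i))) \<le> \<theta> ^ a * (2 * (\<theta> - 1) / real n)" (is "?lhs \<le> _")
  proof -
    have "?lhs \<le> 1 / real n * (\<Sum>k=1..n. \<Sum>l=1..n. r (z k) *
        (1 / real n * \<bar>\<theta> ^ move_particle k l z i - \<theta> ^ z i\<bar>))"
    proof (rule mult_left_mono, intro sum_mono)
      fix k l assume kl: "k \<in> {1..n}" "l \<in> {1..n}"
      show "r (z k) * (((B - profile n (move_particle k l z)) - (B - profile n z)) *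
          (\<theta> ^ move_particle k l z i - \<theta> ^ z i))
        \<le> r (z k) * (1 / real n * \<bar>\<theta> ^ move_particle k l z i - \<theta> ^ z i\<bar>)"
      proof (cases "z k = 0")
        case False
        have "((B - profile n (move_particle k l z)) - (B - profile n z)) *
            (\<theta> ^ move_particle k l z i - \<theta> ^ z i)
          \<le> \<bar>profile n (move_particle k l z) - profile n z\<bar> * \<bar>\<theta> ^ move_particle k l z i - \<theta> ^ z i\<bar>"
          unfolding abs_mult[symmetric] by (smt (verit) minus_mult_left)
        also have "\<dots> \<le> 1 / real n * \<bar>\<theta> ^ move_particle k l z i - \<theta> ^ z i\<bar>"
          by (intro mult_right_mono profile_move[where z=z and k=k and l=l and n=n, OF False kl]) auto
        finally show ?thesis by (intro mult_left_mono r_nonneg)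
      qed (simp add: r_0)
    qed auto
    also have "\<dots> = 1 / real n * (1 / real n * (\<Sum>k=1..n. \<Sum>l=1..n. r (z k) *
        \<bar>\<theta> ^ move_particle k l z i - \<theta> ^ z i\<bar>))"
      by (simp add: sum_distrib_left mult_ac)
    also have "\<dots> = 1 / real n * (q * \<bar>\<theta> ^ Suc a - \<theta> ^ a\<bar> + d * \<bar>\<theta> ^ (a - 1) - \<theta> ^ a\<bar>)"
      using sum_moves_site[OF i, of "\<lambda>v. \<bar>\<theta> ^ v - \<theta> ^ z i\<bar>" z] by (simp add: a_q_\<nu>_def d_def)
    also have "q * \<bar>\<theta> ^ Suc a - \<theta> ^ a\<bar> + d * \<bar>\<theta> ^ (a - 1) - \<theta> ^ a\<bar>
        \<le> 1 * (\<theta> ^ a * (\<theta> - 1)) + 1 * (\<theta> ^ a * (\<theta> - 1))"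
    proof (intro add_mono mult_mono)
      show "\<bar>\<theta> ^ Suc a - \<theta> ^ a\<bar> \<le> \<theta> ^ a * (\<theta> - 1)"
        using \<theta> by (simp add: algebra_simps)
      show "\<bar>\<theta> ^ (a - 1) - \<theta> ^ a\<bar> \<le> \<theta> ^ a * (\<theta> - 1)"
      proof (cases a)
        case (Suc b)
        have "\<theta> ^ b * (\<theta> - 1) \<le> \<theta> ^ Suc b * (\<theta> - 1)"
          using \<theta> by (intro mult_right_mono power_increasing) auto
        moreover have "\<bar>\<theta> ^ b - \<theta> ^ Suc b\<bar> = \<theta> ^ b * (\<theta> - 1)"
          using \<theta> by (simp add: algebra_simps)
        ultimately show ?thesis using Suc by simp
      qed (use \<theta> in auto)
    qed (use q d \<theta> in auto)
    finally show ?thesis using n by (simp add: divide_right_mono field_simps)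
  qed
  have "gen n (\<lambda>z. (B - profile n z) * \<theta> ^ z i) z
      \<le> P * gen n (\<lambda>z. \<theta> ^ z i) z + \<theta> ^ a * gen n (\<lambda>z. B - profile n z) z
        + \<theta> ^ a * (2 * (\<theta> - 1) / real n)"
    using 3 by (simp add: gen_mult P_def a_q_\<nu>_def)
  also have "\<dots> \<le> \<theta> ^ a * (E * (\<theta> + 1) - 2 * \<nu>) + \<theta> ^ a * (2 * \<nu> - eta powr \<rho>)
      + \<theta> ^ a * (2 * (\<theta> - 1) / real n)"
    using 1 2 by (intro add_mono) auto
  finally show ?thesis by (simp add: B_def a_q_\<nu>_def E_def d_def algebra_simps)
qed


section \<open>Two second-class particles\<close>

text \<open>
  Coalescence is encoded by functions that vanish on the diagonal \<open>i = j\<close>: this accounts for the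
  target \<open>l = j\<close> (or \<open>l = i\<close>) in the averages, as well as for the common jump in the last term.
\<close>

definition pair_gen ::
    "nat \<Rightarrow> ((nat \<Rightarrow> nat) \<Rightarrow> nat \<Rightarrow> nat \<Rightarrow> real) \<Rightarrow> (nat \<Rightarrow> nat) \<Rightarrow> nat \<Rightarrow> nat \<Rightarrow> real" where
  "pair_gen n U z i j = gen n (\<lambda>z. U z i j) z
     + max 0 (gap (z i) - gap (z j)) * (avg n (\<lambda>l. U z l j) - U z i j)
     + max 0 (gap (z j) - gap (z i)) * (avg n (\<lambda>l. U z i l) - U z i j)
     - min (gap (z i)) (gap (z j)) * U z i j"

text \<open>The rate \<open>r (z i + 1)\<close> splits into \<open>r (z i)\<close>, at which a
  particle of \<open>z\<close> leaves and the added one stays, and the excess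
  \<open>gap (z i)\<close>, at which the added particle jumps to a uniform site.\<close>

lemma gen_bump:
  assumes n: "1 \<le> n" and i: "i \<in> {1..n}"
  shows "gen n f (bump i z) = gen n (\<lambda>z. f (bump i z)) z
    + gap (z i) * (avg n (\<lambda>l. f (bump l z)) - f (bump i z))"
proof -
  have "r (bump i z k) * (f (move_particle k l (bump i z)) - f (bump i z))
    = r (z k) * (f (bump i (move_particle k l z)) - f (bump i z))
      + (if k = i then gap (z i) * (f (bump l z) - f (bump i z)) else 0)" for k l
  proof (cases "k = i")
    case True
    have "r (z i) * f (bump i (move_particle i l z)) = r (z i) * f (bump l z)"
      by (cases "z i = 0") (auto simp: r_0 move_bump_commute[symmetric] move_bump_self)
    then show ?thesis using True
      by (auto simp: move_bump_self gap_def bump_same algebra_simps)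
  next
    case False
    then have "bump i z k = z k" by (simp add: bump_def)
    with False show ?thesis
      by (cases "z k = 0") (auto simp: move_bump_commute r_0)
  qed
  then have "(\<Sum>k=1..n. \<Sum>l=1..n. r (bump i z k) * (f (move_particle k l (bump i z)) - f (bump i z)))
    = (\<Sum>k=1..n. \<Sum>l=1..n. r (z k) * (f (bump i (move_particle k l z)) - f (bump i z)))
      + (\<Sum>k=1..n. if k = i then (\<Sum>l=1..n. gap (z i) * (f (bump l z) - f (bump i z))) else 0)"
    unfolding sum.distrib[symmetric] by (intro sum.cong) (auto simp: sum.distrib)
  also have "(\<Sum>k=1..n. if k = i then (\<Sum>l=1..n. gap (z i) * (f (bump l z) - f (bump i z))) else 0)
      = gap (z i) * ((\<Sum>l=1..n. f (bump l z)) - real n * f (bump i z))"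
    using i by (simp add: sum_distrib_left[symmetric] sum_subtractf)
  finally have "gen n f (bump i z) = gen n (\<lambda>z. f (bump i z)) z
      + 1 / real n * (gap (z i) * ((\<Sum>l=1..n. f (bump l z)) - real n * f (bump i z)))"
    unfolding zrp_generator_def by (simp only: distrib_left)
  then show ?thesis
    using n by (simp add: avg_def field_simps)
qed

lemma gen_bump_diff:
  assumes "1 \<le> n" "i \<in> {1..n}" "j \<in> {1..n}"
  shows "gen n f (bump i z) - gen n f (bump j z)
    = pair_gen n (\<lambda>z i j. f (bump i z) - f (bump j z)) z i j"
proof -
  \<comment> \<open>\<open>A\<close> is the mean over the targets, the same for both particles.
    During a common jump it cancels, so only the killing term remains at rate
    \<open>min gi gj\<close>.\<close>
  have "max 0 (gi - gj) * ((A - fj) - (fi - fj)) + max 0 (gj - gi) * ((fi - A) - (fi - fj))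
      - min gi gj * (fi - fj) = gi * (A - fi) - gj * (A - fj)" for gi gj A fi fj :: real
    by (cases "gi \<le> gj") (auto simp: max_def min_def algebra_simps)
  note this[of "gap (z i)" "gap (z j)" "avg n (\<lambda>l. f (bump l z))" "f (bump j z)" "f (bump i z)"]
  then show ?thesis
    using assms by (simp add: pair_gen_def gen_bump gen_diff avg_diff avg_const)
qed

lemma pair_gen_cmult_diff:
  "pair_gen n (\<lambda>z i j. a * U z i j - V z i j) z i j = a * pair_gen n U z i j - pair_gen n V z i j"
  unfolding pair_gen_def by (simp add: gen_diff gen_cmult avg_diff avg_cmult algebra_simps)

text \<open>The total jump rate is at most \<open>n\<close>, and moves towards nonnegative values
  can only help.\<close>

lemma gen_ge:
  assumes n: "1 \<le> n" and z: "z \<in> zrp_states n m"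
    and f: "\<And>x. x \<in> zrp_states n m \<Longrightarrow> 0 \<le> f x"
  shows "- real n * f z \<le> gen n f z"
proof -
  have "(\<Sum>k=1..n. \<Sum>l=1..n. - f z) \<le>
      (\<Sum>k=1..n. \<Sum>l=1..n. r (z k) * (f (move_particle k l z) - f z))"
  proof (intro sum_mono)
    fix k l assume l: "l \<in> {1..n}"
    show "- f z \<le> r (z k) * (f (move_particle k l z) - f z)"
    proof (cases "z k = 0")
      case False
      have "r (z k) * f z \<le> 1 * f z"
        using f[OF z] r_le_1 by (intro mult_right_mono)
      moreover have "0 \<le> r (z k) * f (move_particle k l z)"
        by (intro mult_nonneg_nonneg r_nonneg f move_in_states[OF z False l])
      ultimately show ?thesis by (simp add: algebra_simps)
    qed (use f[OF z] in \<open>simp add: r_0\<close>)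
  qed
  then have "1 / real n * (\<Sum>k=1..n. \<Sum>l=1..n. - f z) \<le> gen n f z"
    unfolding zrp_generator_def by (intro mult_left_mono) auto
  then show ?thesis using n by simp
qed

text \<open>Discrete maximum principle. The pair process leaves its state at rate at most
  \<open>n + 1\<close>: \<open>n\<close> for the particles of \<open>z\<close> and
  \<open>max (gap (z i)) (gap (z j)) \<le> 1\<close> for the second-class ones. A short Euler step
  therefore preserves nonnegativity.\<close>

lemma pair_gen_positive:
  assumes n: "1 \<le> n" and z: "z \<in> zrp_states n m" and ij: "i \<in> {1..n}" "j \<in> {1..n}"
    and h: "0 \<le> h" "h * (real n + 1) \<le> 1"
    and U: "\<And>z i j. z \<in> zrp_states n m \<Longrightarrow> i \<in> {1..n} \<Longrightarrow> j \<in> {1..n} \<Longrightarrow> 0 \<le> U z i j"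
  shows "0 \<le> U z i j + h * pair_gen n U z i j"
proof -
  let ?u = "U z i j" and ?gi = "gap (z i)" and ?gj = "gap (z j)"
  have u: "0 \<le> ?u" using U z ij by auto
  have avg: "0 \<le> avg n (\<lambda>l. U z l j)" "0 \<le> avg n (\<lambda>l. U z i l)"
    unfolding avg_def using U z ij by (auto intro!: divide_nonneg_nonneg sum_nonneg)
  have "- real n * ?u \<le> gen n (\<lambda>z. U z i j) z"
    using gen_ge[OF n z, of "\<lambda>z. U z i j"] U ij by auto
  moreover have "- max 0 (?gi - ?gj) * ?u \<le> max 0 (?gi - ?gj) * (avg n (\<lambda>l. U z l j) - ?u)"
    using avg by (simp add: algebra_simps)
  moreover have "- max 0 (?gj - ?gi) * ?u \<le> max 0 (?gj - ?gi) * (avg n (\<lambda>l. U z i l) - ?u)"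
    using avg by (simp add: algebra_simps)
  moreover have "(max 0 (?gi - ?gj) + max 0 (?gj - ?gi) + min ?gi ?gj) * ?u \<le> 1 * ?u"
    using gap_le_1[of "z i"] gap_le_1[of "z j"] gap_nonneg[of "z i"] gap_nonneg[of "z j"]
    by (intro mult_right_mono u) (auto simp: max_def min_def)
  ultimately have "- (real n + 1) * ?u \<le> pair_gen n U z i j"
    unfolding pair_gen_def by (simp add: algebra_simps)
  then have "h * (- (real n + 1) * ?u) \<le> h * pair_gen n U z i j"
    using h by (intro mult_left_mono)
  moreover have "h * (real n + 1) * ?u \<le> 1 * ?u"
    using h u by (intro mult_right_mono)
  ultimately show ?thesis by (simp add: algebra_simps)
qed

text \<open>By the product rule, departures from \<open>i\<close> and \<open>j\<close> gain and
  arrivals lose at most \<open>2 * e z\<close>. The cross term can only be negative for jumps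
  between the two sites, a share \<open>1 / n\<close> of the departures. For
  \<open>n \<ge> 4\<close> half of the gain survives, and half of 8 minus 2 is 2.\<close>

lemma gen_eta_pair:
  assumes n: "4 \<le> n" and ij: "i \<in> {1..n}" "j \<in> {1..n}" "i \<noteq> j"
  defines "e \<equiv> \<lambda>z. eta ^ (z i + z j)"
  shows "- 2 * e z \<le> gen n e z" and "z i + z j \<noteq> 0 \<Longrightarrow> 2 * e z \<le> gen n e z"
proof -
  define ea eb where "ea = eta ^ z i" "eb = eta ^ z j"
  define X where "X = (\<lambda>i. r (z i) * (eta ^ (z i - 1) - eta ^ z i))"
  have e: "0 < ea" "0 < eb" "ea \<le> 1" "eb \<le> 1" using eta_power by (auto simp: ea_eb_def)
  define w where "w = 1 / real n"
  then have w: "w = 1 / real n" "2 / real n = 2 * w" by simp_all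
  have ez: "e z = ea * eb" by (simp add: e_def ea_eb_def power_add)
  have X: "0 \<le> X i" for i
    using eta_bounds r_nonneg by (auto simp: X_def intro!: mult_nonneg_nonneg power_decreasing)
  have X8: "z i \<noteq> 0 \<Longrightarrow> 8 * eta ^ z i \<le> X i" for i
    unfolding X_def by (rule r_eta) auto
  define \<Gamma> where "\<Gamma> = 1 / real n * (\<Sum>k=1..n. \<Sum>l=1..n. r (z k) *
      ((eta ^ move_particle k l z i - ea) * (eta ^ move_particle k l z j - eb)))"
  \<comment> \<open>Only jumps from \<open>i\<close> to \<open>j\<close> or from \<open>j\<close> to
    \<open>i\<close> change both factors; the double sum on the right singles them out.\<close>
  have "- X i * eb - X j * ea = (\<Sum>k=1..n. \<Sum>l=1..n.
      (if k = i then if l = j then - X i * eb else 0 else 0) + (if k = j then if l = i then - X j * ea else 0 else 0))"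
    using ij by (simp only: sum.distrib sum_double_delta)
  also have "\<dots> \<le> (\<Sum>k=1..n. \<Sum>l=1..n. r (z k) *
      ((eta ^ move_particle k l z i - ea) * (eta ^ move_particle k l z j - eb)))"
  proof (intro sum_mono)
    fix k l
    have *: "- X i * eta ^ z j \<le> r (z i) * ((eta ^ (z i - 1) - eta ^ z i) * (eta ^ Suc (z j) - eta ^ z j))" for i j
    proof -
      have "- (eta ^ z j) \<le> eta ^ Suc (z j) - eta ^ z j" using eta_bounds by simp
      from mult_left_mono[OF this X[of i]] show ?thesis by (simp add: X_def mult.assoc)
    qed
    consider "k = i" "l = j" | "k = j" "l = i" | "(k \<noteq> i \<and> l \<noteq> i) \<or> (k \<noteq> j \<and> l \<noteq> j) \<or> k = l"
      using ij by blast
    then show "(if k = i then if l = j then - X i * eb else 0 else 0) +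
        (if k = j then if l = i then - X j * ea else 0 else 0)
      \<le> r (z k) * ((eta ^ move_particle k l z i - ea) * (eta ^ move_particle k l z j - eb))"
    proof cases
      case 1
      then show ?thesis using ij *[of i j] by (simp add: move_particle_def ea_eb_def)
    next
      case 2
      then show ?thesis using ij *[of j i] by (simp add: move_particle_def ea_eb_def mult_ac)
    next
      case 3
      then show ?thesis using ij by (auto simp: move_particle_def ea_eb_def)
    qed
  qed
  finally have "1 / real n * (- X i * eb - X j * ea) \<le> \<Gamma>"
    unfolding \<Gamma>_def by (intro mult_left_mono) auto
  moreover have "eb * ((1 - 1 / real n) * X i - ea) \<le> eb * gen n (\<lambda>z. eta ^ z i) z"
    using gen_eta_site[of n i z] n ij e by (intro mult_left_mono) (auto simp: X_def ea_eb_def)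
  moreover have "ea * ((1 - 1 / real n) * X j - eb) \<le> ea * gen n (\<lambda>z. eta ^ z j) z"
    using gen_eta_site[of n j z] n ij e by (intro mult_left_mono) (auto simp: X_def ea_eb_def)
  moreover have "gen n e z = ea * gen n (\<lambda>z. eta ^ z j) z + eb * gen n (\<lambda>z. eta ^ z i) z + \<Gamma>"
    unfolding e_def power_add gen_mult \<Gamma>_def ea_eb_def ..
  ultimately have "(1 - 2 / real n) * (X i * eb + X j * ea) - 2 * (ea * eb) \<le> gen n e z"
    unfolding w(1)[symmetric] w(2) by (simp add: algebra_simps)
  moreover have "1 / 2 * (X i * eb + X j * ea) \<le> (1 - 2 / real n) * (X i * eb + X j * ea)"
    using n X e by (intro mult_right_mono) (auto simp: field_simps)
  ultimately have *: "1 / 2 * (X i * eb + X j * ea) - 2 * (ea * eb) \<le> gen n e z" by linarith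
  have p: "0 \<le> X i * eb" "0 \<le> X j * ea" using X e by auto
  show "- 2 * e z \<le> gen n e z" using * p unfolding ez distrib_left by linarith
  assume "z i + z j \<noteq> 0"
  then have "8 * (ea * eb) \<le> X i * eb + X j * ea"
  proof (cases "z i = 0")
    case False
    have "8 * ea * eb \<le> X i * eb"
      using X8[OF False] e by (intro mult_right_mono) (auto simp: ea_eb_def)
    with p show ?thesis by simp
  next
    case True
    with \<open>z i + z j \<noteq> 0\<close> have "z j \<noteq> 0" by simp
    then have "8 * eb * ea \<le> X j * ea"
      using X8[of j] e by (intro mult_right_mono) (auto simp: ea_eb_def)
    with p show ?thesis by (simp add: mult_ac)
  qed
  then show "2 * e z \<le> gen n e z" using * unfolding ez distrib_left by linarith
qed


section \<open>Lyapunov functions for a pair and for a site\<close>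

text \<open>Three regimes. If \<open>H\<close>, the sum of the \<open>G\<close> terms, is large, its
  own drift wins. If it is bounded, both heights are below some \<open>K\<close>, and away from the
  bottom the growth of \<open>eta ^ (z i + z j)\<close> compensates the constant. At the bottom,
  killing acts on \<open>C0\<close>.\<close>

lemma pair_supersolution:
  fixes \<theta> c C :: real
  assumes \<theta>: "1 < \<theta>" and c: "0 < c" and C: "0 < C"
  obtains C0 \<Lambda> c3 :: real where "0 < c3" "0 \<le> \<Lambda>" "\<Lambda> + 1 \<le> C0"
    "\<And>n G z i j. \<lbrakk>4 \<le> n; i \<in> {1..n}; j \<in> {1..n}; i \<noteq> j;
        \<And>l. l \<in> {1..n} \<Longrightarrow> \<theta> ^ z l \<le> G l z;
        \<And>l. l \<in> {1..n} \<Longrightarrow> gen n (G l) z \<le> - c * G l z + C\<rbrakk> \<Longrightarrow>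
      pair_gen n (\<lambda>z i j. if i = j then 0 else G i z + G j z + 2 / c * avg n (\<lambda>l. G l z)
            + C0 - \<Lambda> * eta ^ (z i + z j)) z i j
        \<le> - c3 * (G i z + G j z + 2 / c * avg n (\<lambda>l. G l z) + C0)"
proof -
  \<comment> \<open>\<open>C2\<close> collects the constants in the drifts of the three
    \<open>G\<close> terms. A height of at least \<open>K\<close> forces
    \<open>H > 4 * C2 / c\<close>, and \<open>\<Lambda>\<close> makes the \<open>eta\<close> term
    worth at least \<open>2 * C2\<close> below that height. \<open>C0\<close> is large enough for
    killing at rate \<open>r 1\<close> to beat \<open>C2 + 3 * \<Lambda>\<close>: one
    \<open>\<Lambda>\<close> from uniform jumps, two from the drift of the \<open>eta\<close> term
    at the bottom. \<open>c3\<close> is the slowest of the three rates.\<close>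
  define C2 where "C2 = (2 + 2 / c) * C"
  obtain K where K: "4 * C2 / c < \<theta> ^ K" using real_arch_pow[OF \<theta>] by blast
  define \<Lambda> where "\<Lambda> = 2 * C2 / eta ^ (2 * K)"
  define C0 where "C0 = 2 * \<Lambda> + 1 + 2 * (C2 + 3 * \<Lambda>) / r 1"
  define c3 where "c3 = Min {c / 8, C2 / (2 * C0), r 1 / 2}"
  have C2: "0 < C2" using c C by (simp add: C2_def add_pos_pos)
  have \<Lambda>: "0 < \<Lambda>" using C2 eta_power by (simp add: \<Lambda>_def)
  have r1: "0 < r 1" by (rule r_pos) simp
  have q: "0 < 2 * (C2 + 3 * \<Lambda>) / r 1" using C2 \<Lambda> r1 by (intro divide_pos_pos) auto
  have C0: "\<Lambda> + 1 \<le> C0" "0 < C0" using q \<Lambda> by (auto simp: C0_def)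
  have c3: "0 < c3" "c3 \<le> c / 8" "c3 \<le> C2 / (2 * C0)" "c3 \<le> r 1 / 2"
    using c C2 C0 r1 by (auto simp: c3_def)
  have c3C0: "c3 * C0 \<le> C2 / 2"
    using mult_right_mono[OF c3(3), of C0] C0 by simp
  have r1C0: "C2 + 3 * \<Lambda> - r 1 * (C0 - \<Lambda>) \<le> - (r 1 / 2) * C0"
  proof -
    have "r 1 * C0 = 2 * \<Lambda> * r 1 + r 1 + 2 * (C2 + 3 * \<Lambda>)"
      using r1 by (simp add: C0_def field_simps)
    then show ?thesis using r1 by (simp add: algebra_simps)
  qed
  show thesis
  proof (rule that[OF c3(1) _ C0(1)])
    show "0 \<le> \<Lambda>" using \<Lambda> by simp
    fix n G z i j
    assume n: "4 \<le> n" and ij: "i \<in> {1..n}" "j \<in> {1..n}" "i \<noteq> j"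
      and G: "\<And>l. l \<in> {1..n} \<Longrightarrow> \<theta> ^ z l \<le> G l z"
      and gen_G: "\<And>l. l \<in> {1..n} \<Longrightarrow> gen n (G l) z \<le> - c * G l z + C"
    define A where "A = avg n (\<lambda>l. G l z)"
    define e where "e = eta ^ (z i + z j)"
    define H where "H = G i z + G j z + 2 / c * A"
    define W where "W = (\<lambda>z i j. if i = j then 0 else G i z + G j z + 2 / c * avg n (\<lambda>l. G l z)
            + C0 - \<Lambda> * eta ^ (z i + z j))"
    define gi gj where "gi = gap (z i)" "gj = gap (z j)"
    have g: "0 \<le> gi" "gi \<le> 1" "0 \<le> gj" "gj \<le> 1"
      using gap_nonneg gap_le_1 by (auto simp: gi_gj_def)
    have G0: "0 \<le> G l z" if "l \<in> {1..n}" for l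
      using G[OF that] \<theta> zero_le_power[of \<theta> "z l"] by linarith
    have A: "0 \<le> A" unfolding A_def avg_def using G0
      by (intro divide_nonneg_nonneg sum_nonneg) auto
    have e: "0 < e" "e \<le> 1" using eta_power by (auto simp: e_def)
    have \<Lambda>e: "\<Lambda> * e \<le> \<Lambda>" using \<Lambda> e by simp
    have H: "0 \<le> H" using G0 ij A c by (simp add: H_def)
    have Wij: "W z i j = H + C0 - \<Lambda> * e"
      using ij by (simp add: W_def H_def A_def e_def)
    have Wle: "W z k l \<le> G k z + G l z + 2 / c * A + C0" if "k \<in> {1..n}" "l \<in> {1..n}" for k l
      using that G0[of k] G0[of l] A c C0 \<Lambda> eta_power[of "z k + z l"]
      by (auto simp: W_def A_def intro!: add_nonneg_nonneg)
    \<comment> \<open>A uniform jump replaces one of \<open>G i z\<close>, \<open>G j z\<close> by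
      the mean \<open>A\<close>, and at worst the subtracted \<open>\<Lambda> * e\<close>
      disappears. The weight \<open>2 / c\<close> gives the drift \<open>- 2 * A\<close>: one
      \<open>A\<close> pays for these jumps, the other for the decay.\<close>
    have avgs: "avg n (\<lambda>l. W z l j) - W z i j \<le> A + \<Lambda> * e"
               "avg n (\<lambda>l. W z i l) - W z i j \<le> A + \<Lambda> * e"
    proof -
      have "avg n (\<lambda>l. W z l j) \<le> avg n (\<lambda>l. G l z + (G j z + 2 / c * A + C0))"
        using Wle ij by (intro avg_mono) (auto simp: add.assoc)
      moreover have "avg n (\<lambda>l. W z i l) \<le> avg n (\<lambda>l. G l z + (G i z + 2 / c * A + C0))"
        using Wle[OF ij(1)] by (intro avg_mono) (auto simp: algebra_simps)
      ultimately show "avg n (\<lambda>l. W z l j) - W z i j \<le> A + \<Lambda> * e"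
               "avg n (\<lambda>l. W z i l) - W z i j \<le> A + \<Lambda> * e"
        using n G0[OF ij(1)] G0[OF ij(2)]
        by (simp_all add: avg_add[of n "\<lambda>l. G l z"] avg_const A_def[symmetric] Wij H_def)
    qed
    have jumps: "max 0 (gi - gj) * (avg n (\<lambda>l. W z l j) - W z i j)
        + max 0 (gj - gi) * (avg n (\<lambda>l. W z i l) - W z i j) \<le> A + \<Lambda> * e"
    proof -
      have "max 0 (gi - gj) * (avg n (\<lambda>l. W z l j) - W z i j)
          + max 0 (gj - gi) * (avg n (\<lambda>l. W z i l) - W z i j)
        \<le> max 0 (gi - gj) * (A + \<Lambda> * e) + max 0 (gj - gi) * (A + \<Lambda> * e)"
        using avgs by (intro add_mono mult_left_mono) auto
      also have "\<dots> = (max 0 (gi - gj) + max 0 (gj - gi)) * (A + \<Lambda> * e)"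
        by (simp add: algebra_simps)
      also have "\<dots> \<le> 1 * (A + \<Lambda> * e)"
        using g A \<Lambda> e by (intro mult_right_mono) (auto simp: max_def)
      finally show ?thesis by simp
    qed
    have gen_A: "gen n (\<lambda>z. avg n (\<lambda>l. G l z)) z \<le> - c * A + C"
    proof -
      have "avg n (\<lambda>l. gen n (G l) z) \<le> avg n (\<lambda>l. - c * G l z + C)"
        by (intro avg_mono gen_G)
      then show ?thesis using n by (simp add: gen_avg avg_diff avg_cmult avg_const A_def)
    qed
    have "gen n (\<lambda>z. W z i j) z = gen n (G i) z + gen n (G j) z
        + 2 / c * gen n (\<lambda>z. avg n (\<lambda>l. G l z)) z - \<Lambda> * gen n (\<lambda>z. eta ^ (z i + z j)) z"
      using ij by (simp only: W_def gen_add gen_diff gen_cmult gen_const if_False)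
    also have "\<dots> \<le> (- c * G i z + C) + (- c * G j z + C) + 2 / c * (- c * A + C)
        - \<Lambda> * gen n (\<lambda>z. eta ^ (z i + z j)) z"
      using gen_G ij gen_A c by (intro diff_right_mono add_mono mult_left_mono) auto
    also have "\<dots> = - c * (G i z + G j z) - 2 * A + C2 - \<Lambda> * gen n (\<lambda>z. eta ^ (z i + z j)) z"
      using c by (simp add: C2_def field_simps)
    finally have gen_W: "gen n (\<lambda>z. W z i j) z \<le> \<dots>" .
    \<comment> \<open>Of the killing only its effect on the constant part is kept.\<close>
    have "min gi gj * (C0 - \<Lambda>) \<le> min gi gj * W z i j"
      using g Wij H \<Lambda>e by (intro mult_left_mono) auto
    with gen_W jumps have "pair_gen n W z i j \<le> - c * (G i z + G j z) - A + C2
        + \<Lambda> * e - \<Lambda> * gen n (\<lambda>z. eta ^ (z i + z j)) z - min gi gj * (C0 - \<Lambda>)"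
      unfolding pair_gen_def gi_gj_def[symmetric] by linarith
    moreover have "- c * (G i z + G j z) - A \<le> - (c / 2) * H"
    proof -
      have "(c / 2) * H = (c / 2) * (G i z + G j z) + A"
        using c by (simp add: H_def field_simps)
      moreover have "0 \<le> c * (G i z + G j z)"
        using G0[OF ij(1)] G0[OF ij(2)] c by simp
      ultimately show ?thesis by linarith
    qed
    ultimately have main: "pair_gen n W z i j \<le> - (c / 2) * H + C2
        + \<Lambda> * e - \<Lambda> * gen n (\<lambda>z. eta ^ (z i + z j)) z - min gi gj * (C0 - \<Lambda>)"
      by linarith
    have "pair_gen n W z i j \<le> - c3 * (H + C0)"
    proof (cases "z i + z j = 0")
      case True
      then have "min gi gj = r 1" by (simp add: gi_gj_def gap_0)
      moreover have "e = 1" using True by (simp add: e_def)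
      moreover have "\<Lambda> * (- 2 * e) \<le> \<Lambda> * gen n (\<lambda>z. eta ^ (z i + z j)) z"
        using gen_eta_pair(1)[OF n ij, of z] \<Lambda> by (intro mult_left_mono) (auto simp: e_def)
      ultimately have "pair_gen n W z i j \<le> - (c / 2) * H - (r 1 / 2) * C0"
        using main r1C0 by simp
      moreover have "c3 * H \<le> (c / 2) * H" "c3 * C0 \<le> (r 1 / 2) * C0"
        using c3 c H C0 by (intro mult_right_mono; linarith)+
      ultimately show ?thesis by (simp add: algebra_simps)
    next
      case False
      have "\<Lambda> * (2 * e) \<le> \<Lambda> * gen n (\<lambda>z. eta ^ (z i + z j)) z"
        using gen_eta_pair(2)[OF n ij False] \<Lambda> by (intro mult_left_mono) (auto simp: e_def)
      moreover have "0 \<le> min gi gj * (C0 - \<Lambda>)" using g C0 by (intro mult_nonneg_nonneg) auto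
      ultimately have *: "pair_gen n W z i j \<le> - (c / 2) * H + C2 - \<Lambda> * e"
        using main by simp
      have "c3 * (H + C0) \<le> (c / 8) * H + C2 / 2"
        using mult_right_mono[OF c3(2) H] c3C0 by (simp add: algebra_simps)
      \<comment> \<open>Large \<open>H\<close> uses three quarters of its drift against
        \<open>C2\<close>; otherwise both heights are below \<open>K\<close>.\<close>
      moreover have "- (c / 2) * H + C2 - \<Lambda> * e \<le> - (c / 8) * H - C2 / 2"
      proof (cases "4 * C2 / c \<le> H")
        case True
        then have "4 * C2 \<le> c * H" using c by (simp add: field_simps)
        moreover have "0 \<le> \<Lambda> * e" using \<Lambda> e by simp
        ultimately show ?thesis by (simp add: algebra_simps)
      next
        case False
        have "z l < K" if "l = i \<or> l = j" for l
        proof (rule ccontr)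
          assume "\<not> z l < K"
          then have "\<theta> ^ K \<le> \<theta> ^ z l" using \<theta> by (intro power_increasing) auto
          also have "\<dots> \<le> G l z" using that ij G by auto
          also have "\<dots> \<le> H" using that G0[OF ij(1)] G0[OF ij(2)] A c by (auto simp: H_def)
          finally show False using K False by simp
        qed
        then have "eta ^ (2 * K) \<le> e" unfolding e_def
          using eta_bounds by (intro power_decreasing) (auto simp: less_imp_le mult_2 intro!: add_mono)
        then have "\<Lambda> * eta ^ (2 * K) \<le> \<Lambda> * e" using \<Lambda> by (intro mult_left_mono) auto
        moreover have "\<Lambda> * eta ^ (2 * K) = 2 * C2"
          using eta_bounds by (simp add: \<Lambda>_def)
        ultimately have "2 * C2 \<le> \<Lambda> * e" by simp
        moreover have "0 \<le> c * H" using c H by simp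
        ultimately show ?thesis using C2 by (simp add: algebra_simps)
      qed
      ultimately show ?thesis using * by linarith
    qed
    then show "pair_gen n (\<lambda>z i j. if i = j then 0 else G i z + G j z + 2 / c * avg n (\<lambda>l. G l z)
            + C0 - \<Lambda> * eta ^ (z i + z j)) z i j
        \<le> - c3 * (G i z + G j z + 2 / c * avg n (\<lambda>l. G l z) + C0)"
      by (simp add: W_def H_def A_def)
  qed
qed

text \<open>At a high site \<open>r\<close> is close to 1, so for \<open>\<theta>\<close> close to 1
  and \<open>n\<close> large the gain \<open>eta powr \<rho>\<close> dominates the bound of
  \<open>gen_tilted\<close>. Low sites contribute a constant.\<close>

lemma site_lyapunov:
  fixes \<rho> :: real
  assumes \<rho>: "0 \<le> \<rho>"
  obtains \<theta> c C :: real and n0 :: nat where "1 < \<theta>" "0 < c" "0 < C" "4 \<le> n0"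
    "\<And>n m z i. \<lbrakk>n0 \<le> n; z \<in> zrp_states n m; real m \<le> \<rho> * real n; i \<in> {1..n}\<rbrakk> \<Longrightarrow>
      gen n (\<lambda>z. (1 + 2 / (\<theta> - 1) - profile n z) * \<theta> ^ z i) z
        \<le> - c * ((1 + 2 / (\<theta> - 1) - profile n z) * \<theta> ^ z i) + C"
    "\<And>n z (i::nat). n0 \<le> n \<Longrightarrow> \<theta> ^ z i \<le> (1 + 2 / (\<theta> - 1) - profile n z) * \<theta> ^ z i"
    "\<And>n z (i::nat). n0 \<le> n \<Longrightarrow> (1 + 2 / (\<theta> - 1) - profile n z) * \<theta> ^ z i \<le> C * \<theta> ^ z i"
proof -
  define c0 where "c0 = eta powr \<rho>"
  have c0: "0 < c0" "c0 \<le> 1"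
    using eta_bounds \<rho> powr_mono2[of \<rho> eta 1] by (auto simp: c0_def)
  \<comment> \<open>Budget at a high site: \<open>1 - 1 / \<theta>\<close> and
    \<open>1 - r k\<close> are at most \<open>c0 / 16\<close> each and \<open>1 / n\<close> at most
    \<open>c0 / 40\<close>. As \<open>\<theta> + 1 \<le> 3\<close>, the losses add up to at most
    \<open>3 * (c0 / 8 + c0 / 40) + 2 * c0 / 40 = c0 / 2\<close>.\<close>
  define \<theta> where "\<theta> = 1 + c0 / 16"
  have \<theta>: "1 < \<theta>" "\<theta> \<le> 2" "1 - 1 / \<theta> \<le> c0 / 16"
    using c0 by (auto simp: \<theta>_def field_simps)
  define B where "B = 1 + 2 / (\<theta> - 1)"
  have B: "2 \<le> B" using \<theta> by (auto simp: B_def field_simps)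
  have "\<forall>\<^sub>F k in sequentially. 1 - c0 / 16 < r k"
    by (rule order_tendstoD(1)[OF r_lim]) (use c0 in simp)
  then obtain K where K: "\<And>k. K \<le> k \<Longrightarrow> 1 - c0 / 16 < r k"
    unfolding eventually_sequentially by blast
  obtain n1 where n1: "40 / c0 < real n1" using reals_Archimedean2 by blast
  \<comment> \<open>The factor in front of \<open>\<theta> ^ z i\<close> is at most
    \<open>B\<close>, hence the decay \<open>c0 / 2\<close> becomes \<open>c0 / (2 * B)\<close>
    relative to the whole function.\<close>
  define c C where "c = c0 / (2 * B)" "C = 6 * \<theta> ^ K + B"
  have "0 < \<theta> ^ K" using \<theta> by simp
  then have C: "0 < C" "B \<le> C" using B by (auto simp: c_C_def)
  show thesis
  proof (rule that[of \<theta> c C "max 4 n1"])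
    fix n m z i assume n: "max 4 n1 \<le> n" and z: "z \<in> zrp_states n m" "real m \<le> \<rho> * real n"
      and i: "i \<in> {1..n}"
    have inv_n: "1 / real n \<le> c0 / 40"
    proof -
      have "40 < c0 * real n1" using n1 c0 by (simp add: field_simps)
      also have "\<dots> \<le> c0 * real n" using n c0 by (intro mult_left_mono) auto
      finally show ?thesis using n by (simp add: field_simps)
    qed
    define E where "E = 1 - (1 - 1 / real n) * r (z i) / \<theta>"
    have E1: "E \<le> 1" using \<theta> n r_nonneg[of "z i"] by (simp add: E_def)
    have gen: "gen n (\<lambda>z. (B - profile n z) * \<theta> ^ z i) z
        \<le> \<theta> ^ z i * (- c0 + (\<theta> + 1) * E + 2 * (\<theta> - 1) / real n)"
      using gen_tilted[OF \<theta>(1) _ i z] n by (simp add: B_def c0_def E_def)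
    have small: "2 * (\<theta> - 1) / real n \<le> 2 * c0 / 40"
    proof -
      have "2 * (\<theta> - 1) * (1 / real n) \<le> 2 * 1 * (c0 / 40)"
        using \<theta> inv_n c0 by (intro mult_mono) auto
      then show ?thesis by simp
    qed
    have pos: "0 < \<theta> ^ z i" using \<theta> by simp
    have "\<theta> ^ z i * (- c0 + (\<theta> + 1) * E + 2 * (\<theta> - 1) / real n)
        \<le> - (c0 / 2) * \<theta> ^ z i + 6 * \<theta> ^ K"
    proof (cases "K \<le> z i")
      case True
      have "E \<le> (1 - r (z i)) + (1 - 1 / \<theta>) + 1 / real n"
      proof -
        have "1 - (1 - x) * (1 - y) * (1 - w) \<le> x + y + w" if "0 \<le> x" "0 \<le> y" "0 \<le> w" "x \<le> 1" "y \<le> 1" "w \<le> 1" for x y w :: real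
        proof -
          have "(1 - x) * (1 - y) \<ge> 1 - x - y" using that by (simp add: algebra_simps)
          then have "(1 - x) * (1 - y) * (1 - w) \<ge> (1 - x - y) * (1 - w)"
            using that by (intro mult_right_mono) auto
          moreover have "(1 - x - y) * (1 - w) \<ge> 1 - x - y - w"
            using that by (simp add: algebra_simps)
          ultimately show ?thesis by linarith
        qed
        from this[of "1 / real n" "1 - r (z i)" "1 - 1 / \<theta>"] show ?thesis
          using n \<theta> r_nonneg[of "z i"] r_le_1[of "z i"] by (simp add: E_def)
      qed
      also have "\<dots> \<le> c0 / 16 + c0 / 16 + c0 / 40"
        using K[OF True] \<theta> inv_n by (intro add_mono) auto
      finally have "(\<theta> + 1) * E \<le> (\<theta> + 1) * (c0 / 8 + c0 / 40)"
        using \<theta> by (intro mult_left_mono) auto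
      also have "\<dots> \<le> 3 * (c0 / 8 + c0 / 40)"
        using \<theta> c0 by (intro mult_right_mono) auto
      finally have "(\<theta> + 1) * E + 2 * (\<theta> - 1) / real n \<le> 3 * (c0 / 8 + c0 / 40) + 2 * c0 / 40"
        by (intro add_mono small)
      also have "\<dots> = c0 - c0 / 2" by (simp add: field_simps)
      finally have "- c0 + (\<theta> + 1) * E + 2 * (\<theta> - 1) / real n \<le> - (c0 / 2)"
        by linarith
      then have "\<theta> ^ z i * (- c0 + (\<theta> + 1) * E + 2 * (\<theta> - 1) / real n) \<le> \<theta> ^ z i * - (c0 / 2)"
        using pos by (intro mult_left_mono) auto
      moreover have "0 \<le> 6 * \<theta> ^ K" using \<theta> by simp
      ultimately show ?thesis by (simp only: mult.commute)
    next
      case False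
      have "(\<theta> + 1) * E \<le> 3 * 1" using \<theta> E1
        by (intro order_trans[OF mult_left_mono[OF E1]]) auto
      then have "- c0 + (\<theta> + 1) * E + 2 * (\<theta> - 1) / real n \<le> 6 - c0 / 2"
        using small c0 by linarith
      then have "\<theta> ^ z i * (- c0 + (\<theta> + 1) * E + 2 * (\<theta> - 1) / real n) \<le> \<theta> ^ z i * (6 - c0 / 2)"
        using pos by (intro mult_left_mono) auto
      moreover have "\<theta> ^ z i \<le> \<theta> ^ K" using \<theta> False by (intro power_increasing) auto
      ultimately show ?thesis by (simp add: algebra_simps)
    qed
    moreover have "c * ((B - profile n z) * \<theta> ^ z i) \<le> (c0 / 2) * \<theta> ^ z i"
    proof -
      have "c * (B - profile n z) \<le> c * B"
        using profile_nonneg B c0 by (intro mult_left_mono) (auto simp: c_C_def)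
      also have "\<dots> = c0 / 2" using B by (simp add: c_C_def)
      finally show ?thesis using pos mult_right_mono[of "c * (B - profile n z)" "c0 / 2" "\<theta> ^ z i"]
        by (simp add: mult.assoc)
    qed
    ultimately show "gen n (\<lambda>z. (1 + 2 / (\<theta> - 1) - profile n z) * \<theta> ^ z i) z
        \<le> - c * ((1 + 2 / (\<theta> - 1) - profile n z) * \<theta> ^ z i) + C"
      using gen B unfolding B_def[symmetric] by (simp add: c_C_def)
  next
    fix n z and i :: nat assume n: "max 4 n1 \<le> n"
    have pos: "0 \<le> \<theta> ^ z i" using \<theta> by simp
    have "1 \<le> B - profile n z" "B - profile n z \<le> C"
      using profile_le_1[of n z] profile_nonneg[of n z] B C n by auto
    from mult_right_mono[OF this(1) pos] mult_right_mono[OF this(2) pos]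
    show "\<theta> ^ z i \<le> (1 + 2 / (\<theta> - 1) - profile n z) * \<theta> ^ z i"
      "(1 + 2 / (\<theta> - 1) - profile n z) * \<theta> ^ z i \<le> C * \<theta> ^ z i"
      by (auto simp: B_def)
  qed (use \<theta> c0 B C in \<open>auto simp: c_C_def(1)\<close>)
qed


text \<open>The upper bound on \<open>W\<close> is symmetric in the sites and increasing in the
  heights, so it can be controlled along a chain of moves. The last property turns into a bound on
  the stationary mean of the same sum, since \<open>gen n G\<close> has mean zero at
  equilibrium.\<close>

lemma pair_lyapunov:
  fixes \<rho> :: real
  assumes "0 \<le> \<rho>"
  obtains \<theta> c K D :: real and n0 :: nat where "1 < \<theta>" "0 < c" "0 < K" "0 < D" "4 \<le> n0"
    "\<And>n m. \<lbrakk>n0 \<le> n; real m \<le> \<rho> * real n\<rbrakk> \<Longrightarrow>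
      \<exists>W. \<forall>z\<in>zrp_states n m. \<forall>i\<in>{1..n}. \<forall>j\<in>{1..n}. W z i i = 0 \<and> (i \<noteq> j \<longrightarrow>
        1 \<le> W z i j \<and> pair_gen n W z i j \<le> - c * W z i j) \<and> W z i j \<le> K * (\<Sum>l=1..n. \<theta> ^ z l)"
    "\<And>n m. \<lbrakk>n0 \<le> n; real m \<le> \<rho> * real n\<rbrakk> \<Longrightarrow>
      \<exists>G. \<forall>z\<in>zrp_states n m. (\<Sum>l=1..n. \<theta> ^ z l) \<le> D * real n - gen n G z"
proof (rule site_lyapunov[OF assms])
  fix \<theta> c C :: real and n0 :: nat
  assume \<theta>: "1 < \<theta>" and cC: "0 < c" "0 < C" and n0: "4 \<le> n0"
    and gen: "\<And>n m z i. \<lbrakk>n0 \<le> n; z \<in> zrp_states n m; real m \<le> \<rho> * real n; i \<in> {1..n}\<rbrakk> \<Longrightarrow>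
      gen n (\<lambda>z. (1 + 2 / (\<theta> - 1) - profile n z) * \<theta> ^ z i) z
        \<le> - c * ((1 + 2 / (\<theta> - 1) - profile n z) * \<theta> ^ z i) + C"
    and lower: "\<And>n z (i::nat). n0 \<le> n \<Longrightarrow> \<theta> ^ z i \<le> (1 + 2 / (\<theta> - 1) - profile n z) * \<theta> ^ z i"
    and upper: "\<And>n z (i::nat). n0 \<le> n \<Longrightarrow> (1 + 2 / (\<theta> - 1) - profile n z) * \<theta> ^ z i \<le> C * \<theta> ^ z i"
  define G where "G = (\<lambda>n i z. (1 + 2 / (\<theta> - 1) - profile n z) * \<theta> ^ z i)"
  show thesis
  proof (rule pair_supersolution[OF \<theta> cC])
    fix C0 \<Lambda> c3 :: real
    assume c3: "0 < c3" and \<Lambda>: "0 \<le> \<Lambda>" "\<Lambda> + 1 \<le> C0"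
      and super: "\<And>n G z i j. \<lbrakk>4 \<le> n; i \<in> {1..n}; j \<in> {1..n}; i \<noteq> j;
          \<And>l. l \<in> {1..n} \<Longrightarrow> \<theta> ^ z l \<le> G l z;
          \<And>l. l \<in> {1..n} \<Longrightarrow> gen n (G l) z \<le> - c * G l z + C\<rbrakk> \<Longrightarrow>
        pair_gen n (\<lambda>z i j. if i = j then 0 else G i z + G j z + 2 / c * avg n (\<lambda>l. G l z)
              + C0 - \<Lambda> * eta ^ (z i + z j)) z i j
          \<le> - c3 * (G i z + G j z + 2 / c * avg n (\<lambda>l. G l z) + C0)"
    \<comment> \<open>Each \<open>G\<close> and their mean are at most \<open>C * S\<close>, where
      \<open>S\<close> is the sum over the sites; \<open>S \<ge> 1\<close> absorbs
      \<open>C0\<close>.\<close>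
    define K where "K = 2 * C + 2 / c * C + C0"
    have K: "0 < K" using cC \<Lambda> by (simp add: K_def add_pos_pos)
    have W: "\<exists>W. \<forall>z\<in>zrp_states n m. \<forall>i\<in>{1..n}. \<forall>j\<in>{1..n}. W z i i = 0 \<and> (i \<noteq> j \<longrightarrow>
          1 \<le> W z i j \<and> pair_gen n W z i j \<le> - c3 * W z i j) \<and> W z i j \<le> K * (\<Sum>l=1..n. \<theta> ^ z l)"
      if n: "n0 \<le> n" and m: "real m \<le> \<rho> * real n" for n m
    proof (intro exI ballI)
      define W where "W = (\<lambda>z i j. if i = j then 0 else
        G n i z + G n j z + 2 / c * avg n (\<lambda>l. G n l z) + C0 - \<Lambda> * eta ^ (z i + z j))"
      fix z i j assume z: "z \<in> zrp_states n m" and ij: "i \<in> {1..n}" "j \<in> {1..n}"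
      define S where "S = (\<Sum>l=1..n. \<theta> ^ z l)"
      have G: "0 \<le> G n l z" "G n l z \<le> C * \<theta> ^ z l" for l
        using lower[OF n, of z l] upper[OF n, of z l] \<theta> zero_le_power[of \<theta> "z l"]
        by (auto simp: G_def intro: order_trans)
      have mem: "\<theta> ^ z l \<le> S" if "l \<in> {1..n}" for l
        unfolding S_def using that \<theta> by (intro member_le_sum) auto
      have S1: "1 \<le> S" using mem[OF ij(1)] \<theta> one_le_power[of \<theta> "z i"] by linarith
      have GS: "G n l z \<le> C * S" if "l \<in> {1..n}" for l
        using G(2)[of l] mult_left_mono[OF mem[OF that], of C] cC by linarith
      have avg: "0 \<le> avg n (\<lambda>l. G n l z)" "avg n (\<lambda>l. G n l z) \<le> C * S"
        using avg_mono[of n "\<lambda>l. 0" "\<lambda>l. G n l z"] avg_mono[of n "\<lambda>l. G n l z" "\<lambda>l. C * S"] G GS n n0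
        by (auto simp: avg_const)
      have e: "0 \<le> \<Lambda> * eta ^ (z i + z j)" "\<Lambda> * eta ^ (z i + z j) \<le> \<Lambda>"
        using \<Lambda> eta_power[of "z i + z j"] by (auto simp: mult_left_le)
      have avg_c: "0 \<le> 2 / c * avg n (\<lambda>l. G n l z)" "2 / c * avg n (\<lambda>l. G n l z) \<le> 2 / c * (C * S)"
        using avg cC by (auto intro!: mult_left_mono divide_right_mono)
      have "W z i j \<le> K * S"
      proof (cases "i = j")
        case False
        have "C0 * 1 \<le> C0 * S" using S1 \<Lambda> by (intro mult_left_mono) auto
        moreover have "W z i j = G n i z + G n j z + 2 / c * avg n (\<lambda>l. G n l z) + C0
            - \<Lambda> * eta ^ (z i + z j)"
          using False by (simp add: W_def)
        ultimately have "W z i j \<le> C * S + C * S + 2 / c * (C * S) + C0 * S"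
          using GS[OF ij(1)] GS[OF ij(2)] avg_c e by linarith
        then show ?thesis by (simp add: K_def algebra_simps)
      qed (use K S1 in \<open>simp add: W_def\<close>)
      moreover have "1 \<le> W z i j \<and> pair_gen n W z i j \<le> - c3 * W z i j" if "i \<noteq> j"
      proof
        show "1 \<le> W z i j" using that G[of i] G[of j] avg_c e \<Lambda> by (simp add: W_def)
        have "pair_gen n W z i j \<le> - c3 * (G n i z + G n j z + 2 / c * avg n (\<lambda>l. G n l z) + C0)"
          unfolding W_def using n n0 z ij that lower[OF n] gen[OF n z m]
          by (intro super) (auto simp: G_def)
        also have "\<dots> \<le> - c3 * W z i j"
          using that e c3 by (simp add: W_def)
        finally show "pair_gen n W z i j \<le> - c3 * W z i j" .
      qed
      ultimately show "W z i i = 0 \<and> (i \<noteq> j \<longrightarrow>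
          1 \<le> W z i j \<and> pair_gen n W z i j \<le> - c3 * W z i j) \<and> W z i j \<le> K * (\<Sum>l=1..n. \<theta> ^ z l)"
        by (auto simp: S_def) (simp add: W_def)
    qed
    have G: "\<exists>F. \<forall>z\<in>zrp_states n m. (\<Sum>l=1..n. \<theta> ^ z l) \<le> C / c * real n - gen n F z"
      if n: "n0 \<le> n" and m: "real m \<le> \<rho> * real n" for n m
    proof (intro exI ballI)
      fix z assume z: "z \<in> zrp_states n m"
      have "(\<Sum>l=1..n. c * \<theta> ^ z l) \<le> (\<Sum>l=1..n. C - gen n (G n l) z)"
      proof (rule sum_mono)
        fix l assume "l \<in> {1..n}"
        from gen[OF n z m this] mult_left_mono[OF lower[OF n, of z l], of c] cC
        show "c * \<theta> ^ z l \<le> C - gen n (G n l) z" unfolding G_def by linarith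
      qed
      also have "\<dots> = C * real n - gen n (\<lambda>z. \<Sum>l=1..n. G n l z) z"
        by (simp add: gen_sum sum_subtractf)
      finally have "1 / c * (\<Sum>l=1..n. c * \<theta> ^ z l) \<le> 1 / c * (C * real n - gen n (\<lambda>z. \<Sum>l=1..n. G n l z) z)"
        using cC by (intro mult_left_mono) auto
      then show "(\<Sum>l=1..n. \<theta> ^ z l) \<le> C / c * real n - gen n (\<lambda>z. 1 / c * (\<Sum>l=1..n. G n l z)) z"
        unfolding gen_cmult using cC by (simp add: sum_distrib_left[symmetric] algebra_simps diff_divide_distrib)
    qed
    show thesis
      using that[OF \<theta> c3 K _ n0 W G] cC by simp
  qed
qed

section \<open>Equilibrium and convergence\<close>

text \<open>This is detailed balance: weight times departure rate of the added particle depends on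
  \<open>z\<close> only.\<close>

lemma zrp_weight_bump:
  assumes "i \<in> {1..n}"
  shows "zrp_weight r n (bump i z) * r (Suc (z i)) = zrp_weight r n z"
proof -
  have "zrp_weight r n (bump i z) = (\<Prod>k=1..z i + 1. 1 / r k) * (\<Prod>l\<in>{1..n}-{i}. \<Prod>k=1..z l. 1 / r k)"
    unfolding zrp_weight_def using assms
    by (subst prod.remove[of _ i]) (auto simp: bump_def intro!: prod.cong)
  moreover have "zrp_weight r n z = (\<Prod>k=1..z i. 1 / r k) * (\<Prod>l\<in>{1..n}-{i}. \<Prod>k=1..z l. 1 / r k)"
    unfolding zrp_weight_def using assms by (subst prod.remove[of _ i]) auto
  ultimately show ?thesis using r_pos[of "Suc (z i)"] by simp
qed

lemma zrp_weight_pos: "0 < zrp_weight r n z"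
  unfolding zrp_weight_def using r_pos by (auto intro!: prod_pos)

lemma gen_stationary:
  "(\<Sum>x\<in>zrp_states n (Suc m). zrp_weight r n x * gen n f x) = 0"
proof -
  define S where "S = zrp_states n (Suc m)"
  \<comment> \<open>Once the jumping particle is removed, its origin appears only in
    \<open>g\<close>. The remaining double sum over origin and target is antisymmetric, hence
    zero.\<close>
  have *: "(\<Sum>x\<in>S. zrp_weight r n x * (r (x k) * g x)) =
      (\<Sum>z\<in>zrp_states n m. zrp_weight r n z * g (bump k z))" if k: "k \<in> {1..n}" for k g
  proof -
    have "(\<Sum>x\<in>S. zrp_weight r n x * (r (x k) * g x)) =
        (\<Sum>x\<in>{x \<in> S. x k \<noteq> 0}. zrp_weight r n x * (r (x k) * g x))"
      by (rule sum.mono_neutral_right) (auto simp: S_def finite_zrp_states r_0)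
    also have "\<dots> = (\<Sum>z\<in>zrp_states n m. zrp_weight r n (bump k z) * (r (bump k z k) * g (bump k z)))"
      unfolding S_def occupied_states_eq_bump_image[OF k]
      by (subst sum.reindex) (auto intro: inj_on_subset[OF inj_bump])
    also have "\<dots> = (\<Sum>z\<in>zrp_states n m. zrp_weight r n z * g (bump k z))"
      by (simp add: bump_same mult.assoc[symmetric] zrp_weight_bump[OF k])
    finally show ?thesis .
  qed
  have "(\<Sum>x\<in>S. zrp_weight r n x * gen n f x) = 1 / real n * (\<Sum>k=1..n. \<Sum>l=1..n.
      \<Sum>x\<in>S. zrp_weight r n x * (r (x k) * (f (move_particle k l x) - f x)))"
    unfolding zrp_generator_def sum_distrib_left
    by (subst sum.swap[where A=S], intro sum.cong refl, subst sum.swap[where A=S]) (simp add: mult_ac)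
  also have "(\<Sum>k=1..n. \<Sum>l=1..n.
      \<Sum>x\<in>S. zrp_weight r n x * (r (x k) * (f (move_particle k l x) - f x)))
    = (\<Sum>k=1..n. \<Sum>l=1..n. (\<Sum>z\<in>zrp_states n m. zrp_weight r n z * f (bump l z))
        - (\<Sum>z\<in>zrp_states n m. zrp_weight r n z * f (bump k z)))"
    by (intro sum.cong refl, subst *)
      (simp_all add: move_bump_self right_diff_distrib sum_subtractf)
  also have "\<dots> = 0"
    by (simp add: sum_subtractf sum_distrib_left)
  finally show ?thesis by (simp add: S_def)
qed

section \<open>Euler steps for the backward equation\<close>

text \<open>The short step comes first, so the observable is the probability after time
  \<open>s\<close>. It lies in \<open>[0, 1]\<close>, which makes \<open>h0\<close> independent of
  \<open>s\<close> and \<open>A\<close>.\<close>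

lemma prob_euler_step:
  assumes p: "transition_function (zrp_states n m) p" and gen: "has_generator (zrp_states n m) p (gen n)"
    and e: "0 < e"
  obtains h0 where "0 < h0"
    "\<And>h (s :: real) x A. \<lbrakk>0 < h; h < h0; 0 \<le> s; x \<in> zrp_states n m\<rbrakk> \<Longrightarrow>
      \<bar>measure_pmf.prob (p (h + s) x) A - measure_pmf.prob (p s x) A
        - h * gen n (\<lambda>x. measure_pmf.prob (p s x) A) x\<bar> \<le> h * e"
proof -
  obtain h0 where h0: "0 < h0"
    "\<And>h g x. \<lbrakk>0 < h; h < h0; \<And>y. y \<in> zrp_states n m \<Longrightarrow> \<bar>g y\<bar> \<le> 1; x \<in> zrp_states n m\<rbrakk> \<Longrightarrow>
      \<bar>measure_pmf.expectation (p h x) g - g x - h * gen n g x\<bar> \<le> h * e"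
    using transition_uniform_derivative[OF p gen finite_zrp_states e gen_expand] by metis
  show thesis
  proof (rule that[OF h0(1)])
    fix h s :: real and x A assume h: "0 < h" "h < h0" and s: "0 \<le> s" and x: "x \<in> zrp_states n m"
    show "\<bar>measure_pmf.prob (p (h + s) x) A - measure_pmf.prob (p s x) A
        - h * gen n (\<lambda>x. measure_pmf.prob (p s x) A) x\<bar> \<le> h * e"
      using h0(2)[OF h _ x, of "\<lambda>x. measure_pmf.prob (p s x) A"] h s
      by (simp add: transition_prob_add[OF p x])
  qed
qed

text \<open>The difference of the two probabilities evolves by \<open>pair_gen\<close>, and
  \<open>a * W\<close> is a supersolution. By positivity of the Euler step, \<open>a * W\<close>
  keeps dominating the difference while \<open>a\<close> shrinks by \<open>1 - c * h\<close> per
  step, up to errors that vanish with \<open>e\<close>.\<close>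

lemma pair_contraction:
  assumes p: "transition_function (zrp_states n (Suc m)) p"
    and gen: "has_generator (zrp_states n (Suc m)) p (gen n)"
    and n: "1 \<le> n" and c: "0 < c"
    and W: "\<And>z i j. \<lbrakk>z \<in> zrp_states n m; i \<in> {1..n}; j \<in> {1..n}\<rbrakk> \<Longrightarrow>
      W z i i = 0 \<and> (i \<noteq> j \<longrightarrow> 1 \<le> W z i j \<and> pair_gen n W z i j \<le> - c * W z i j)"
    and t: "0 < t" and z: "z \<in> zrp_states n m" and ij: "i \<in> {1..n}" "j \<in> {1..n}"
  shows "measure_pmf.prob (p t (bump i z)) A - measure_pmf.prob (p t (bump j z)) A \<le> exp (- (c * t)) * W z i j"
proof (rule le_if_le_add_epsilon)
  have W0: "0 \<le> W z i j" if "z \<in> zrp_states n m" "i \<in> {1..n}" "j \<in> {1..n}" for z i j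
    using W[OF that] by (cases "i = j") auto
  show "0 \<le> 2 * t * W z i j" using W0[OF z ij] t by simp
  fix e :: real assume e: "0 < e"
  define F where "F = (\<lambda>s x. measure_pmf.prob (p s x) A)"
  obtain h0 where h0: "0 < h0" and step: "\<And>h s x. \<lbrakk>0 < h; h < h0; 0 \<le> s; x \<in> zrp_states n (Suc m)\<rbrakk> \<Longrightarrow>
      \<bar>F (h + s) x - F s x - h * gen n (F s) x\<bar> \<le> h * e"
    unfolding F_def using prob_euler_step[OF p gen e] by metis
  \<comment> \<open>The three bounds serve the Euler error, the maximum principle and
    \<open>1 - c * h \<ge> 0\<close>.\<close>
  define \<delta> where "\<delta> = Min {h0, 1 / (real n + 1), 1 / c}"
  have "0 < \<delta>" using h0 c by (auto simp: \<delta>_def)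
  then obtain h and N :: nat where h: "0 < h" "h < \<delta>" and N: "real N * h = t"
    using equal_steps[OF t] by metis
  have h': "h < h0" "h * (real n + 1) \<le> 1" "c * h \<le> 1"
    using h c by (auto simp: \<delta>_def field_simps)
  \<comment> \<open>Each step adds one Euler error \<open>h * e\<close> per configuration; off the
    diagonal \<open>W \<ge> 1\<close> absorbs them, and on it both sides vanish.\<close>
  have "F (real k * h) (bump i z) - F (real k * h) (bump j z)
      \<le> ((1 - c * h) ^ k + 2 * real k * h * e) * W z i j"
    if "z \<in> zrp_states n m" "i \<in> {1..n}" "j \<in> {1..n}" for k z i j
    using that
  proof (induction k arbitrary: z i j)
    case 0
    have "F 0 (bump i z) - F 0 (bump j z) \<le> 1"
      unfolding F_def using measure_pmf.prob_le_1 measure_nonneg by (smt (verit))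
    then show ?case using W[OF 0] by (cases "i = j") auto
  next
    case (Suc k)
    note z = Suc.prems(1) and ij = Suc.prems(2,3)
    show ?case
    proof (cases "i = j")
      case False
      define a where "a = (1 - c * h) ^ k + 2 * real k * h * e"
      have a: "0 \<le> a" using h h' e by (simp add: a_def)
      define f where "f = F (real k * h)"
      define u where "u = (\<lambda>z i j. f (bump i z) - f (bump j z))"
      have "0 \<le> (a * W z i j - u z i j) + h * pair_gen n (\<lambda>z i j. a * W z i j - u z i j) z i j"
      proof (rule pair_gen_positive[OF n z ij _ h'(2), where U="\<lambda>z i j. a * W z i j - u z i j"])
        fix z i j assume "z \<in> zrp_states n m" "i \<in> {1..n}" "j \<in> {1..n}"
        from Suc.IH[OF this] show "0 \<le> a * W z i j - u z i j"
          by (simp add: u_def f_def a_def)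
      qed (use h in auto)
      then have 1: "u z i j + h * pair_gen n u z i j \<le> a * W z i j + h * (a * pair_gen n W z i j)"
        by (simp add: pair_gen_cmult_diff algebra_simps)
      have w: "1 \<le> W z i j" "pair_gen n W z i j \<le> - c * W z i j" using W[OF z ij] False by auto
      have 2: "h * (a * pair_gen n W z i j) \<le> h * (a * (- c * W z i j))"
        using h a w by (intro mult_left_mono) auto
      have 3: "2 * (h * e) * 1 \<le> 2 * (h * e) * W z i j"
        using w h e by (intro mult_left_mono) auto
      have s: "0 \<le> real k * h" using h by simp
      have b: "bump i z \<in> zrp_states n (Suc m)" "bump j z \<in> zrp_states n (Suc m)"
        using z ij bump_in_states by auto
      have "F (real (Suc k) * h) (bump i z) - F (real (Suc k) * h) (bump j z)
          \<le> u z i j + h * (gen n f (bump i z) - gen n f (bump j z)) + 2 * (h * e)"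
        using step[OF h(1) h'(1) s b(1)] step[OF h(1) h'(1) s b(2)]
        by (simp add: u_def f_def algebra_simps abs_le_iff)
      also have "\<dots> \<le> a * W z i j + h * (a * (- c * W z i j)) + 2 * (h * e) * W z i j"
        using 1 2 3 unfolding gen_bump_diff[OF n ij] u_def by linarith
      also have "\<dots> = (a * (1 - c * h) + 2 * h * e) * W z i j"
        by (simp add: algebra_simps)
      also have "\<dots> \<le> ((1 - c * h) ^ Suc k + 2 * real (Suc k) * h * e) * W z i j"
      proof (rule mult_right_mono)
        have "2 * real k * h * e * (1 - c * h) \<le> 2 * real k * h * e * 1"
          using h e c by (intro mult_left_mono) auto
        then show "a * (1 - c * h) + 2 * h * e \<le> (1 - c * h) ^ Suc k + 2 * real (Suc k) * h * e"
          by (simp add: a_def algebra_simps)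
      qed (use w in simp)
      finally show ?thesis .
    qed (use W[OF Suc.prems] in simp)
  qed
  from this[OF z ij, of N] have "F t (bump i z) - F t (bump j z)
      \<le> ((1 - c * h) ^ N + 2 * t * e) * W z i j"
    by (simp add: N mult.assoc)
  also have "\<dots> \<le> (exp (- (c * t)) + 2 * t * e) * W z i j"
    using power_one_minus_le_exp[OF h'(3), of N] W0[OF z ij]
    by (intro mult_right_mono add_right_mono) (auto simp: N[symmetric] mult_ac)
  finally show "measure_pmf.prob (p t (bump i z)) A - measure_pmf.prob (p t (bump j z)) A
      \<le> exp (- (c * t)) * W z i j + 2 * t * W z i j * e"
    by (simp add: F_def algebra_simps)
qed

text \<open>The weighted sum of \<open>gen n f\<close> is zero, so an Euler step changes the
  weighted sum of probabilities by at most \<open>h * e * Z\<close>. Over time \<open>t\<close> this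
  is \<open>t * e * Z\<close> with \<open>e\<close> arbitrary.\<close>

lemma weight_invariant:
  assumes p: "transition_function (zrp_states n (Suc m)) p"
    and gen: "has_generator (zrp_states n (Suc m)) p (gen n)" and t: "0 < t"
  shows "(\<Sum>x\<in>zrp_states n (Suc m). zrp_weight r n x * measure_pmf.prob (p t x) A)
    = (\<Sum>x\<in>zrp_states n (Suc m). zrp_weight r n x * indicat_real A x)"
proof -
  define S w where "S = zrp_states n (Suc m)" and "w = zrp_weight r n"
  define F where "F = (\<lambda>s x. measure_pmf.prob (p s x) A)"
  have w: "0 \<le> w x" for x using zrp_weight_pos by (simp add: w_def less_imp_le)
  define Z where "Z = sum w S"
  have Z: "0 \<le> Z" using w by (simp add: Z_def sum_nonneg)
  have "\<bar>(\<Sum>x\<in>S. w x * F t x) - (\<Sum>x\<in>S. w x * F 0 x)\<bar> \<le> 0"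
  proof (rule le_if_le_add_epsilon)
    show "0 \<le> t * Z" using t Z by simp
    fix e :: real assume e: "0 < e"
    obtain h0 where h0: "0 < h0" and step: "\<And>h s x. \<lbrakk>0 < h; h < h0; 0 \<le> s; x \<in> S\<rbrakk> \<Longrightarrow>
        \<bar>F (h + s) x - F s x - h * gen n (F s) x\<bar> \<le> h * e"
      unfolding F_def S_def using prob_euler_step[OF p gen e] by metis
    obtain h and N :: nat where h: "0 < h" "h < h0" and N: "real N * h = t"
      using equal_steps[OF t h0] by metis
    have "\<bar>(\<Sum>x\<in>S. w x * F (real k * h) x) - (\<Sum>x\<in>S. w x * F 0 x)\<bar> \<le> real k * h * e * Z" for k
    proof (induction k)
      case (Suc k)
      define f where "f = F (real k * h)"
      have "(\<Sum>x\<in>S. w x * F (h + real k * h) x) - (\<Sum>x\<in>S. w x * f x) - h * (\<Sum>x\<in>S. w x * gen n f x)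
          = (\<Sum>x\<in>S. w x * (F (h + real k * h) x - f x - h * gen n f x))"
        by (simp add: sum_subtractf sum.distrib sum_distrib_left algebra_simps)
      also have "\<bar>\<dots>\<bar> \<le> (\<Sum>x\<in>S. w x * (h * e))"
        using step[OF h, of "real k * h"] w h
        by (intro order_trans[OF sum_abs] sum_mono) (auto simp: abs_mult f_def intro!: mult_left_mono)
      also have "\<dots> = h * e * Z" by (simp add: Z_def sum_distrib_left mult_ac)
      finally have "\<bar>(\<Sum>x\<in>S. w x * F (h + real k * h) x) - (\<Sum>x\<in>S. w x * f x)\<bar> \<le> h * e * Z"
        using gen_stationary[where n=n and m=m and f=f] by (simp add: S_def w_def)
      with Suc.IH show ?case by (simp add: f_def algebra_simps abs_le_iff)
    qed simp
    from this[of N] show "\<bar>(\<Sum>x\<in>S. w x * F t x) - (\<Sum>x\<in>S. w x * F 0 x)\<bar> \<le> 0 + t * Z * e"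
      unfolding N by (simp add: mult_ac)
  qed
  moreover have "F 0 x = indicat_real A x" if "x \<in> S" for x
    using p that by (simp add: F_def S_def transition_function_def)
  ultimately show ?thesis by (simp add: F_def S_def w_def)
qed

lemma measure_zrp_equilibrium:
  assumes A: "A \<subseteq> zrp_states n m"
  shows "measure (zrp_equilibrium r n m) A
    = (\<Sum>y\<in>A. zrp_weight r n y) / (\<Sum>y\<in>zrp_states n m. zrp_weight r n y)"
proof -
  define Z where "Z = (\<Sum>y\<in>zrp_states n m. zrp_weight r n y)"
  have fin: "finite A" using A finite_zrp_states finite_subset by blast
  have pos: "0 \<le> zrp_weight r n y / Z" for y
    unfolding Z_def by (intro divide_nonneg_nonneg sum_nonneg less_imp_le[OF zrp_weight_pos])
  have "emeasure (zrp_equilibrium r n m) A = (\<Sum>y\<in>A. ennreal (zrp_weight r n y / Z))"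
    unfolding zrp_equilibrium_def Z_def using A fin by (intro emeasure_point_measure_finite2)
  also have "\<dots> = ennreal (\<Sum>y\<in>A. zrp_weight r n y / Z)"
    using pos by (intro sum_ennreal) auto
  finally show ?thesis
    using pos by (simp add: measure_def Z_def sum_divide_distrib sum_nonneg)
qed

section \<open>From one moved particle to total variation\<close>

text \<open>By invariance, the distance to equilibrium on \<open>A\<close> is a weighted mean of
  differences \<open>F x - F y\<close>. Each is a sum of at most \<open>m\<close> contractions along
  a chain of moves, and the prefactor \<open>T y\<close> has stationary mean of order
  \<open>n\<close>.\<close>

lemma tv_bound:
  fixes \<rho> :: real
  assumes "0 \<le> \<rho>"
  obtains \<theta> c K :: real and n0 :: nat where "1 < \<theta>" "0 < c" "0 < K" "4 \<le> n0"
    "\<And>n m x P t. \<lbrakk>n0 \<le> n; 1 \<le> m; real m \<le> \<rho> * real n; x \<in> zrp_states n m; zrp_law r n m x P; 0 < t\<rbrakk> \<Longrightarrow>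
      tv_dist (zrp_states n m) (distr P (count_space (zrp_states n m)) (\<lambda>\<omega>. \<omega> t)) (zrp_equilibrium r n m)
        \<le> K * real n ^ 2 * \<theta> ^ sup_norm n x * exp (- (c * t))"
proof (rule pair_lyapunov[OF assms])
  fix \<theta> c K D :: real and n0 :: nat
  assume \<theta>: "1 < \<theta>" and c: "0 < c" and K: "0 < K" and D: "0 < D" and n0: "4 \<le> n0"
    and exW: "\<And>n m. \<lbrakk>n0 \<le> n; real m \<le> \<rho> * real n\<rbrakk> \<Longrightarrow>
      \<exists>W. \<forall>z\<in>zrp_states n m. \<forall>i\<in>{1..n}. \<forall>j\<in>{1..n}. W z i i = 0 \<and> (i \<noteq> j \<longrightarrow>
        1 \<le> W z i j \<and> pair_gen n W z i j \<le> - c * W z i j) \<and> W z i j \<le> K * (\<Sum>l=1..n. \<theta> ^ z l)"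
    and exG: "\<And>n m. \<lbrakk>n0 \<le> n; real m \<le> \<rho> * real n\<rbrakk> \<Longrightarrow>
      \<exists>G. \<forall>z\<in>zrp_states n m. (\<Sum>l=1..n. \<theta> ^ z l) \<le> D * real n - gen n G z"
  \<comment> \<open>One factor \<open>n\<close> comes from \<open>m \<le> (\<rho> + 1) * n\<close>
    moves, the other from \<open>T\<close>.\<close>
  define K' where "K' = (\<rho> + 1) * K * (1 + D)"
  have K': "0 < K'" using K D assms by (simp add: K'_def)
  show thesis
  proof (rule that[OF \<theta> c K' n0])
    fix n m :: nat and x P and t :: real
    assume n: "n0 \<le> n" and m1: "1 \<le> m" and m: "real m \<le> \<rho> * real n"
      and x: "x \<in> zrp_states n m" and P: "zrp_law r n m x P" and t: "0 < t"
    obtain m' where m': "m = Suc m'" using m1 by (cases m) auto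
    define S where "S = zrp_states n m"
    have fin: "finite S" by (simp add: S_def finite_zrp_states)
    obtain p where p: "transition_function S p" "has_generator S p (gen n)"
      and marg: "\<And>t A. \<lbrakk>0 \<le> t; A \<subseteq> S\<rbrakk> \<Longrightarrow>
        measure (distr P (count_space S) (\<lambda>\<omega>. \<omega> t)) A = measure_pmf.prob (p t x) A"
      using markov_chain_law_marginal[OF P[unfolded zrp_law_def] finite_zrp_states x]
      unfolding S_def by metis
    have "real m' \<le> \<rho> * real n" using m m' by simp
    from exW[OF n this] obtain W where W: "\<And>z i j. \<lbrakk>z \<in> zrp_states n m'; i \<in> {1..n}; j \<in> {1..n}\<rbrakk> \<Longrightarrow>
        W z i i = 0 \<and> (i \<noteq> j \<longrightarrow> 1 \<le> W z i j \<and> pair_gen n W z i j \<le> - c * W z i j)"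
      and WK: "\<And>z i j. \<lbrakk>z \<in> zrp_states n m'; i \<in> {1..n}; j \<in> {1..n}\<rbrakk> \<Longrightarrow>
        W z i j \<le> K * (\<Sum>l=1..n. \<theta> ^ z l)" by blast
    obtain G where G: "\<And>z. z \<in> S \<Longrightarrow> (\<Sum>l=1..n. \<theta> ^ z l) \<le> D * real n - gen n G z"
      using exG[OF n m] unfolding S_def by blast
    have n1: "1 \<le> n" using n n0 by simp
    define T where "T = (\<lambda>z. \<Sum>l=1..n. \<theta> ^ z l)"
    define w where "w = zrp_weight r n"
    define Z where "Z = sum w S"
    have w: "0 < w y" for y using zrp_weight_pos by (simp add: w_def)
    have Z: "0 < Z" unfolding Z_def using w x fin by (intro sum_pos) (auto simp: S_def)
    have wT: "(\<Sum>y\<in>S. w y * T y) \<le> D * real n * Z"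
    proof -
      have "(\<Sum>y\<in>S. w y * T y) \<le> (\<Sum>y\<in>S. w y * (D * real n - gen n G y))"
        using G w by (intro sum_mono mult_left_mono) (auto simp: T_def less_imp_le)
      also have "\<dots> = (\<Sum>y\<in>S. w y) * (D * real n) - (\<Sum>y\<in>S. w y * gen n G y)"
        by (simp add: right_diff_distrib sum_subtractf sum_distrib_right)
      also have "(\<Sum>y\<in>S. w y * gen n G y) = 0"
        using gen_stationary[where n=n and m=m' and f=G] by (simp add: S_def w_def m')
      finally show ?thesis by (simp add: Z_def mult_ac)
    qed
    have Tx: "T x \<le> real n * \<theta> ^ sup_norm n x"
    proof -
      have "T x \<le> (\<Sum>l=1..n. \<theta> ^ sup_norm n x)"
        unfolding T_def using \<theta> by (intro sum_mono power_increasing) (auto simp: sup_norm_def)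
      then show ?thesis by simp
    qed
    show "tv_dist (zrp_states n m) (distr P (count_space (zrp_states n m)) (\<lambda>\<omega>. \<omega> t)) (zrp_equilibrium r n m)
        \<le> K' * real n ^ 2 * \<theta> ^ sup_norm n x * exp (- (c * t))"
      unfolding S_def[symmetric]
    proof (rule tv_dist_le[OF fin])
      fix A assume A: "A \<subseteq> S"
      define F where "F = (\<lambda>y. measure_pmf.prob (p t y) A)"
      define a where "a = real m * K * exp (- (c * t))"
      have a: "0 \<le> a" using K by (simp add: a_def)
      have osc: "F y - F y' \<le> a * (T y + T y')" if y: "y \<in> S" "y' \<in> S" for y y'
      proof -
        \<comment> \<open>Heights along the chain stay below the sitewise maximum, and a power of
          the maximum is at most the sum of both powers.\<close>
        have "F y - F y' \<le> real m * (exp (- (c * t)) * (K * (T y + T y')))"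
        proof (rule oscillation_le_sum_of_moves[where n=n and u="\<lambda>k. max (y k) (y' k)"])
          show "0 \<le> exp (- (c * t)) * (K * (T y + T y'))"
            using K \<theta> by (auto simp: T_def intro!: mult_nonneg_nonneg add_nonneg_nonneg sum_nonneg)
          fix z i j assume ij: "i \<in> {1..n}" "j \<in> {1..n}" and b: "bump i z \<in> zrp_states n m"
            and z: "\<And>k. z k \<le> max (y k) (y' k)"
          have zS: "z \<in> zrp_states n m'" using b bump_in_states[OF ij(1)] by (simp add: m')
          have "F (bump i z) - F (bump j z) \<le> exp (- (c * t)) * W z i j"
            unfolding F_def using p[unfolded S_def m'] n1 c W t zS ij by (rule pair_contraction)
          also have "\<dots> \<le> exp (- (c * t)) * (K * T z)"
            using WK[OF zS ij] by (intro mult_left_mono) (auto simp: T_def)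
          also have "T z \<le> T y + T y'"
            unfolding T_def sum.distrib[symmetric]
          proof (rule sum_mono)
            fix l
            have "\<theta> ^ z l \<le> \<theta> ^ max (y l) (y' l)" using z \<theta> by (intro power_increasing) auto
            also have "\<dots> \<le> \<theta> ^ y l + \<theta> ^ y' l" using \<theta> by (auto simp: max_def)
            finally show "\<theta> ^ z l \<le> \<theta> ^ y l + \<theta> ^ y' l" .
          qed
          finally show "F (bump i z) - F (bump j z) \<le> exp (- (c * t)) * (K * (T y + T y'))"
            using K by simp
        qed (use y in \<open>auto simp: S_def\<close>)
        then show ?thesis by (simp add: a_def mult_ac)
      qed
      have inv: "(\<Sum>y\<in>S. w y * F y) = sum w A"
      proof -
        have "(\<Sum>y\<in>S. w y * F y) = (\<Sum>y\<in>S. w y * indicat_real A y)"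
          unfolding F_def w_def S_def m' by (rule weight_invariant[OF p[unfolded S_def m'] t])
        also have "\<dots> = (\<Sum>y\<in>A. w y)"
          using A fin by (intro sum.mono_neutral_cong_right) auto
        finally show ?thesis .
      qed
      have "Z * \<bar>F x - sum w A / Z\<bar> = \<bar>\<Sum>y\<in>S. w y * (F x - F y)\<bar>"
      proof -
        have "(\<Sum>y\<in>S. w y * (F x - F y)) = Z * F x - sum w A"
          by (simp add: right_diff_distrib sum_subtractf inv Z_def sum_distrib_right)
        also have "\<dots> = Z * (F x - sum w A / Z)" using Z by (simp add: right_diff_distrib)
        finally show ?thesis using Z by (simp add: abs_mult)
      qed
      also have "\<dots> \<le> (\<Sum>y\<in>S. w y * (a * (T x + T y)))"
      proof (intro order_trans[OF sum_abs] sum_mono)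
        fix y assume y: "y \<in> S"
        have "\<bar>F x - F y\<bar> \<le> a * (T x + T y)"
          using osc[OF _ y, of x] osc[OF y, of x] x by (auto simp: S_def abs_le_iff add.commute)
        then show "\<bar>w y * (F x - F y)\<bar> \<le> w y * (a * (T x + T y))"
          using w[of y] by (simp add: abs_mult)
      qed
      also have "\<dots> = a * (Z * T x + (\<Sum>y\<in>S. w y * T y))"
        by (simp add: Z_def sum_distrib_left sum_distrib_right sum.distrib algebra_simps)
      also have "\<dots> \<le> a * (Z * (real n * \<theta> ^ sup_norm n x) + D * real n * Z * \<theta> ^ sup_norm n x)"
      proof (intro mult_left_mono add_mono a)
        show "(\<Sum>y\<in>S. w y * T y) \<le> D * real n * Z * \<theta> ^ sup_norm n x"
        proof -
          have "D * real n * Z * 1 \<le> D * real n * Z * \<theta> ^ sup_norm n x"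
            using D Z \<theta> by (intro mult_left_mono one_le_power) auto
          with wT show ?thesis by simp
        qed
      qed (use Tx Z in auto)
      also have "\<dots> = Z * (a * ((1 + D) * real n * \<theta> ^ sup_norm n x))"
        by (simp add: algebra_simps)
      finally have "\<bar>F x - sum w A / Z\<bar> \<le> a * ((1 + D) * real n * \<theta> ^ sup_norm n x)"
        using Z by simp
      also have "\<dots> \<le> ((\<rho> + 1) * real n * K * exp (- (c * t))) * ((1 + D) * real n * \<theta> ^ sup_norm n x)"
      proof -
        have "real m \<le> (\<rho> + 1) * real n" using m by (simp add: distrib_right)
        then show ?thesis
          unfolding a_def using K D \<theta> by (intro mult_right_mono) auto
      qed
      also have "\<dots> = K' * real n ^ 2 * \<theta> ^ sup_norm n x * exp (- (c * t))"
        by (simp add: K'_def power2_eq_square)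
      finally show "\<bar>measure (distr P (count_space S) (\<lambda>\<omega>. \<omega> t)) A - measure (zrp_equilibrium r n m) A\<bar>
          \<le> K' * real n ^ 2 * \<theta> ^ sup_norm n x * exp (- (c * t))"
        using marg[OF _ A, of t] t measure_zrp_equilibrium[of A n m] A
        by (simp add: F_def S_def w_def Z_def)
    qed
  qed
qed

end

section \<open>Choice of the constant and of the time\<close>

theorem theorem2:
  fixes r :: "nat \<Rightarrow> real" and \<rho> :: real
  assumes "r 0 = 0"
    and "\<And>k. 1 \<le> k \<Longrightarrow> 0 < r k"
    and "mono_on {1..} r"
    and "r \<longlonglongrightarrow> 1"
    and "0 < \<rho>"
  shows "\<exists>\<kappa>::real. 0 < \<kappa> \<and>
    (\<forall>n m :: nat. 1 \<le> n \<and> 1 \<le> m \<and> real m / real n \<le> \<rho> \<longrightarrow>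
      (\<forall>x \<in> zrp_states n m. \<forall>P. zrp_law r n m x P \<longrightarrow>
        (\<forall>\<epsilon>::real. 0 < \<epsilon> \<and> \<epsilon> < 1 \<and> \<kappa> / \<epsilon> \<le> real n \<longrightarrow>
          mixing_time (zrp_states n m) P (zrp_equilibrium r n m) \<epsilon>
            \<le> ereal (\<kappa> * real (sup_norm n x) + ln (real n) powr \<kappa>))))"
proof -
  interpret zrp_rate r using assms by unfold_locales auto
  show ?thesis
  proof (rule tv_bound[of \<rho>])
    show "0 \<le> \<rho>" using assms(5) by simp
    fix \<theta> c K :: real and n0 :: nat
    assume \<theta>: "1 < \<theta>" and c: "0 < c" and K: "0 < K" and n0: "4 \<le> n0"
      and tv: "\<And>n m x P t. \<lbrakk>n0 \<le> n; 1 \<le> m; real m \<le> \<rho> * real n; x \<in> zrp_states n m; zrp_law r n m x P; 0 < t\<rbrakk> \<Longrightarrow>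
      tv_dist (zrp_states n m) (distr P (count_space (zrp_states n m)) (\<lambda>\<omega>. \<omega> t)) (zrp_equilibrium r n m)
        \<le> K * real n ^ 2 * \<theta> ^ sup_norm n x * exp (- (c * t))"
    \<comment> \<open>\<open>K\<close> yields \<open>K / n \<le> \<epsilon>\<close>,
      \<open>n0\<close> makes the bound applicable, \<open>exp (exp 1)\<close> ensures
      \<open>ln n \<ge> exp 1\<close>, and the last two terms are the times per unit of
      \<open>sup_norm n x\<close> and of \<open>ln n\<close> needed for decay.\<close>
    define \<kappa> where "\<kappa> = K + real n0 + exp (exp 1) + ln \<theta> / c + 3 / c"
    have pos: "0 < ln \<theta> / c" "0 < 3 / c" "0 < exp (exp (1::real))" using \<theta> c by auto
    have \<kappa>: "K \<le> \<kappa>" "real n0 \<le> \<kappa>" "exp (exp 1) \<le> \<kappa>" "ln \<theta> / c \<le> \<kappa>" "3 / c \<le> \<kappa>"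
      using pos K unfolding \<kappa>_def by linarith+
    have \<kappa>0: "0 < \<kappa>" using \<kappa>(1) K by linarith
    have c\<kappa>: "ln \<theta> \<le> c * \<kappa>" "3 \<le> c * \<kappa>"
      using \<kappa>(4,5) c by (simp_all add: pos_divide_le_eq mult.commute)
    have "mixing_time (zrp_states n m) P (zrp_equilibrium r n m) \<epsilon>
        \<le> ereal (\<kappa> * real (sup_norm n x) + ln (real n) powr \<kappa>)"
      if n: "1 \<le> n" and m: "1 \<le> m" "real m / real n \<le> \<rho>" and x: "x \<in> zrp_states n m"
        and P: "zrp_law r n m x P" and \<epsilon>: "0 < \<epsilon>" "\<epsilon> < 1" "\<kappa> / \<epsilon> \<le> real n" for n m x P \<epsilon>
    proof (rule mixing_time_le)
      define M where "M = sup_norm n x"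
      define l where "l = ln (real n)"
      define t where "t = \<kappa> * real M + l powr \<kappa>"
      have \<kappa>n: "\<kappa> \<le> \<epsilon> * real n" using \<epsilon> by (simp add: field_simps)
      also have "\<dots> \<le> 1 * real n" using \<epsilon> by (intro mult_right_mono) auto
      finally have n\<kappa>: "\<kappa> \<le> real n" by simp
      have l: "exp 1 \<le> l"
        unfolding l_def using \<kappa>(3) n\<kappa> n by (subst ln_ge_iff) auto
      then have l0: "0 < l" using exp_gt_zero[of "1::real"] by linarith
      \<comment> \<open>As \<open>ln n \<ge> exp 1\<close>, the power \<open>l powr \<kappa>\<close>
        dominates the linear term \<open>\<kappa> * l\<close> that the decay needs.\<close>
      have "\<kappa> \<le> exp (\<kappa> - 1)" using exp_ge_add_one_self[of "\<kappa> - 1"] by simp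
      also have "\<dots> = exp 1 powr (\<kappa> - 1)" by (simp add: powr_def)
      also have "\<dots> \<le> l powr (\<kappa> - 1)"
      proof (rule powr_mono2)
        have "1 \<le> exp (exp (1::real))" by simp
        with \<kappa>(3) show "0 \<le> \<kappa> - 1" by linarith
      qed (use l in auto)
      finally have "\<kappa> * l \<le> l powr (\<kappa> - 1) * l" using l0 by (intro mult_right_mono) auto
      also have "\<dots> = l powr \<kappa>" using l0 by (simp add: powr_diff)
      finally have t_ge: "\<kappa> * real M + \<kappa> * l \<le> t" by (simp add: t_def)
      have "0 < \<kappa> * l" using \<kappa>0 l0 by simp
      moreover have "0 \<le> \<kappa> * real M" using \<kappa>0 by simp
      ultimately have t: "0 < t" using t_ge by linarith
      show "0 \<le> \<kappa> * real (sup_norm n x) + ln (real n) powr \<kappa>"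
        using t by (simp add: t_def M_def l_def)
      \<comment> \<open>Three powers of \<open>n\<close> are removed although the prefactor has two:
        the spare \<open>1 / n\<close> meets \<open>n \<ge> \<kappa> / \<epsilon>\<close>.\<close>
      have "real M * ln \<theta> + 3 * l \<le> real M * (c * \<kappa>) + (c * \<kappa>) * l"
        using c\<kappa> l0 by (intro add_mono mult_left_mono mult_right_mono) auto
      also have "\<dots> = c * (\<kappa> * real M + \<kappa> * l)" by (simp add: algebra_simps)
      also have "\<dots> \<le> c * t" using t_ge c by (intro mult_left_mono) auto
      finally have "exp (- (c * t)) \<le> exp (- (real M * ln \<theta> + 3 * l))" by simp
      also have "\<dots> = 1 / (\<theta> ^ M * real n ^ 3)"
      proof -
        have "exp (real M * ln \<theta>) = \<theta> ^ M" "exp (3 * l) = real n ^ 3"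
          using \<theta> n exp_of_nat_mult[of M "ln \<theta>"] exp_of_nat_mult[of 3 l] by (auto simp: l_def)
        then show ?thesis by (simp only: exp_minus exp_add divide_inverse mult_1)
      qed
      finally have e: "exp (- (c * t)) \<le> 1 / (\<theta> ^ M * real n ^ 3)" .
      have "tv_dist (zrp_states n m) (distr P (count_space (zrp_states n m)) (\<lambda>\<omega>. \<omega> t)) (zrp_equilibrium r n m)
          \<le> K * real n ^ 2 * \<theta> ^ M * exp (- (c * t))"
        unfolding M_def using tv[OF _ m(1) _ x P t] n m(2) \<kappa>(2) n\<kappa> by (simp add: field_simps)
      also have "\<dots> \<le> K * real n ^ 2 * \<theta> ^ M * (1 / (\<theta> ^ M * real n ^ 3))"
        using e K \<theta> by (intro mult_left_mono) auto
      also have "\<dots> = K / real n"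
        using \<theta> n by (simp add: power2_eq_square power3_eq_cube field_simps)
      also have "\<dots> \<le> \<epsilon>"
        using \<kappa>n \<kappa>(1) n by (simp add: field_simps)
      finally show "tv_dist (zrp_states n m) (distr P (count_space (zrp_states n m))
          (\<lambda>\<omega>. \<omega> (\<kappa> * real (sup_norm n x) + ln (real n) powr \<kappa>))) (zrp_equilibrium r n m) \<le> \<epsilon>"
        by (simp add: t_def M_def l_def)
    qed
    then show ?thesis using \<kappa>0 by blast
  qed
qed

end
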